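(* For each $1\le n\le\omega$, the equivalence relation $=^{+n}$ is in the spectrum of the meager ideal; that is, there is an equivalence relation $F$ on a Polish space $Y$ such that $F$ and $=^{+n}$ are Borel bireducible and for every non-meager (Borel) set $C\subseteq Y$, $F\restriction C$ is Borel bireducible with $F$.
   Context: Friedman–Stanley jumps: for an equivalence relation $E$ on $X$, $E^+$ on $X^{\mathbb N}$ is $x\mathrel{E^+}y\iff\{[x(i)]_E:i\in\mathbb N\}=\{[y(i)]_E:i\in\mathbb N\}$. $=^{+0}$ is equality on $\mathbb R$, $=^{+(n+1)}=(=^{+n})^+$, and $=^{+\omega}=\prod_{n<\omega}=^{+n}$ (product equivalence relation on the product of the domains: coordinatewise equivalence). $E\le_B F$ means there is a Borel reduction; Borel bireducible means $\le_B$ in both directions. *)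

theory Defs
  imports "HOL-Analysis.Analysis" "HOL-Library.Extended_Nat"
begin

definition Polish_space :: "'a topology \<Rightarrow> bool" where
  "Polish_space X \<longleftrightarrow> completely_metrizable_space X \<and> separable_space X"

definition borel_of :: "'a topology \<Rightarrow> 'a measure" where
  "borel_of X = sigma (topspace X) {U. openin X U}"

definition nowhere_dense_in :: "'a topology \<Rightarrow> 'a set \<Rightarrow> bool" where
  "nowhere_dense_in X A \<longleftrightarrow> A \<subseteq> topspace X \<and> X interior_of (X closure_of A) = {}"

definition meager_in :: "'a topology \<Rightarrow> 'a set \<Rightarrow> bool" where
  "meager_in X A \<longleftrightarrow> A \<subseteq> topspace X \<and>
     (\<exists>N :: nat \<Rightarrow> 'a set. (\<forall>k. nowhere_dense_in X (N k)) \<and> A \<subseteq> (\<Union>k. N k))"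

definition equivalence_on :: "'a set \<Rightarrow> ('a \<Rightarrow> 'a \<Rightarrow> bool) \<Rightarrow> bool" where
  "equivalence_on S E \<longleftrightarrow> (\<forall>x\<in>S. E x x) \<and> (\<forall>x\<in>S. \<forall>y\<in>S. E x y \<longrightarrow> E y x) \<and>
     (\<forall>x\<in>S. \<forall>y\<in>S. \<forall>z\<in>S. E x y \<longrightarrow> E y z \<longrightarrow> E x z)"

definition borel_reducible ::
  "'a measure \<Rightarrow> ('a \<Rightarrow> 'a \<Rightarrow> bool) \<Rightarrow> 'b measure \<Rightarrow> ('b \<Rightarrow> 'b \<Rightarrow> bool) \<Rightarrow> bool" where
  "borel_reducible M E N F \<longleftrightarrow>
     (\<exists>f \<in> M \<rightarrow>\<^sub>M N. \<forall>x\<in>space M. \<forall>y\<in>space M. E x y \<longleftrightarrow> F (f x) (f y))"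

definition borel_bireducible ::
  "'a measure \<Rightarrow> ('a \<Rightarrow> 'a \<Rightarrow> bool) \<Rightarrow> 'b measure \<Rightarrow> ('b \<Rightarrow> 'b \<Rightarrow> bool) \<Rightarrow> bool" where
  "borel_bireducible M E N F \<longleftrightarrow> borel_reducible M E N F \<and> borel_reducible N F M E"

text \<open>Encoding. The domain of =^{+n} is X_0 = \<real>,
  X_{n+1} = X_n^\<nat>, canonically homeomorphic to \<real>^(\<nat>^n).
  We represent a point of X_n as a function x :: nat list \<Rightarrow> real
  which vanishes off the lists of length n; the n-th component
  x(i) \<in> X_n of x \<in> X_{n+1} is \<lambda>s. x (i # s).
  The domain of =^{+\<omega>}, \<Prod>_n X_n, is then all of
  \<real>^(\<nat>^{<\<omega>}), the n-th coordinate being the restriction to lists of length n.\<close>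

definition FS_component :: "(nat list \<Rightarrow> real) \<Rightarrow> nat \<Rightarrow> (nat list \<Rightarrow> real)" where
  "FS_component x i = (\<lambda>s. x (i # s))"

fun FS_eq_fin :: "nat \<Rightarrow> (nat list \<Rightarrow> real) \<Rightarrow> (nat list \<Rightarrow> real) \<Rightarrow> bool" where
  "FS_eq_fin 0 x y \<longleftrightarrow> x [] = y []"
| "FS_eq_fin (Suc n) x y \<longleftrightarrow>
     (\<forall>i. \<exists>j. FS_eq_fin n (FS_component x i) (FS_component y j)) \<and>
     (\<forall>j. \<exists>i. FS_eq_fin n (FS_component x i) (FS_component y j))"

definition FS_proj :: "nat \<Rightarrow> (nat list \<Rightarrow> real) \<Rightarrow> (nat list \<Rightarrow> real)" where
  "FS_proj n x = (\<lambda>s. if length s = n then x s else 0)"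

definition FS_space :: "enat \<Rightarrow> (nat list \<Rightarrow> real) topology" where
  "FS_space n = (case n of
      enat k \<Rightarrow> subtopology (powertop_real UNIV) {x. \<forall>s. length s \<noteq> k \<longrightarrow> x s = 0}
    | \<infinity> \<Rightarrow> powertop_real UNIV)"

definition FS_eq :: "enat \<Rightarrow> (nat list \<Rightarrow> real) \<Rightarrow> (nat list \<Rightarrow> real) \<Rightarrow> bool" where
  "FS_eq n x y = (case n of
      enat k \<Rightarrow> FS_eq_fin k x y
    | \<infinity> \<Rightarrow> (\<forall>k. FS_eq_fin k (FS_proj k x) (FS_proj k y)))"

end

theory Submission
  imports Defs "HOL-Library.Sublist" "HOL-Library.Countable" "HOL-Library.Nat_Bijection"
begin

text \<open>
  Points of the space code a tower of sorts: sort 0 is a countable family of reals, and every element of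
  sort \<open>k + 1\<close> is a subset of sort \<open>k\<close>; for a generic code all these subsets are mutually generic.
  The relation compares the sets of hereditary sets at the top (at all levels for \<open>n = \<infinity>\<close>), hence it
  reduces to \<open>=\<^sup>+\<^sup>n\<close> by decoding.

  Conversely, a non-meager Borel set \<open>C\<close> contains, by the Baire property, every code that extends a
  finite condition \<open>p\<close> and meets countably many dense sets \<open>U r\<close>. The hereditary elements of a point
  \<open>x\<close> are replaced by names, i.e. pairs of a finite list of elements and a natural number (the tag).
  Whether a name is linked to a name of the next sort depends only on the two tags and on the membership
  matrix of the two lists, and the larger tag decides; so every finite pattern of links is realised by a
  new name with a large tag. At sort 0 the names are labelled by a Mycielski family of mutually generic
  sequences. Enumerating all names, up to equivalence and without repetition, while meeting the dense sets
  gives a code in \<open>C\<close>, Borel in \<open>x\<close>, whose sets of hereditary sets depend only on the class of \<open>x\<close>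
  and determine it: a set of the next sort determines its tag and the classes in its list.
\<close>

section \<open>Perfectly many mutually generic sequences\<close>

text \<open>The code cannot be an invariant of \<open>x\<close>: the index that a name receives is
  chosen so as to meet the dense sets, and only the target relation forgets indices. Hence labels
  and links must be functions of the classes alone, and the order of enumeration is all that can be
  adjusted. True membership among the hereditary elements of \<open>x\<close> is too rigid for this,
  since a finite pattern demanded by a condition need not occur in it. Padding the elements with
  tags creates the missing patterns: a name chosen late has a large tag and so dictates its links to
  the earlier names, in both directions. Sort 0 behaves differently. A link is one bit and can be
  postponed, but a name of sort 0 brings in an infinite row at once, which no later choice can
  change. A dense set must therefore be met by finitely many rows that are already complete, and
  this is what mutual genericity of a perfect family provides. The family is indexed by a tag and a
  branch: tags prescribe arbitrary finite prefixes, and the branch codes the list of classes, for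
  which there are continuum many possibilities.\<close>

lemma prefix_map_upt: "a \<le> b \<Longrightarrow> prefix (map f [0..<a]) (map f [0..<b])"
  by (metis le0 le_add_diff_inverse map_append prefixI upt_add_eq_append)

text \<open>Density handles the requirements one after the other; monotonicity keeps the earlier
  ones satisfied while the words grow.\<close>

lemma finite_requirements_extension:
  fixes D :: "nat \<Rightarrow> bool list list \<Rightarrow> bool" and \<phi> :: "'a \<Rightarrow> bool list"
  assumes dense: "\<And>d u. \<exists>u'. list_all2 prefix u u' \<and> D d u'"
    and mono: "\<forall>d u u'. D d u \<longrightarrow> list_all2 prefix u u' \<longrightarrow> D d u'"
    and "finite Q" "\<forall>(d, ns)\<in>Q. distinct ns"
  shows "\<exists>\<phi>'. (\<forall>a. prefix (\<phi> a) (\<phi>' a)) \<and> (\<forall>(d, ns)\<in>Q. D d (map \<phi>' ns))"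
  using assms(3,4)
proof (induction Q rule: finite_induct)
  case empty
  show ?case by (intro exI[of _ \<phi>]) auto
next
  case (insert z Q)
  obtain d ns where z: "z = (d, ns)" by fastforce
  have "\<forall>(d, ns)\<in>Q. distinct ns" using insert.prems by auto
  from insert.IH[OF this] obtain \<phi>1 where \<phi>1: "(\<forall>a. prefix (\<phi> a) (\<phi>1 a)) \<and> (\<forall>(d, ns)\<in>Q. D d (map \<phi>1 ns))"
    by blast
  then have 1: "\<And>a. prefix (\<phi> a) (\<phi>1 a)" "\<And>d ns. (d, ns) \<in> Q \<Longrightarrow> D d (map \<phi>1 ns)"
    by auto
  have dist: "distinct ns" using insert.prems z by auto
  obtain u' where u': "list_all2 prefix (map \<phi>1 ns) u'" "D d u'" using dense by blast
  have len: "length u' = length ns" using u'(1) by (auto simp: list_all2_conv_all_nth)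
  \<comment> \<open>Distinctness of \<open>ns\<close> makes this overwriting consistent: each node
    receives one new word.\<close>
  define \<phi>2 where "\<phi>2 = (\<lambda>a. case map_of (zip ns u') a of None \<Rightarrow> \<phi>1 a | Some v \<Rightarrow> v)"
  have m: "\<phi>2 (ns ! i) = u' ! i" if "i < length ns" for i
    unfolding \<phi>2_def using map_of_zip_nth[OF len[symmetric] dist that[folded len]] by simp
  have mm: "map \<phi>2 ns = u'" using m len by (intro nth_equalityI) auto
  have p2: "prefix (\<phi>1 a) (\<phi>2 a)" for a
  proof (cases "a \<in> set ns")
    case True
    then obtain i where "i < length ns" "a = ns ! i" by (auto simp: in_set_conv_nth)
    then show ?thesis using u'(1) m by (auto simp: list_all2_conv_all_nth)
  next
    case False
    then have "map_of (zip ns u') a = None" using len by (simp add: map_of_zip_is_None)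
    then show ?thesis by (simp add: \<phi>2_def)
  qed
  have "D d' (map \<phi>2 ns')" if "(d', ns') \<in> insert z Q" for d' ns'
  proof (cases "(d', ns') = z")
    case True then show ?thesis using z mm u' by auto
  next
    case False
    then have "D d' (map \<phi>1 ns')" using that 1 by auto
    then show ?thesis by (rule mono[rule_format]) (auto simp: list_all2_conv_all_nth p2)
  qed
  moreover have "prefix (\<phi> a) (\<phi>2 a)" for a using 1(1) p2 prefix_order.trans by blast
  ultimately show ?case by (intro exI[of _ \<phi>2]) auto
qed

lemma finite_lists_of_length: "finite {u :: bool list. length u = r}"
  using finite_lists_length_eq[of "UNIV :: bool set" r] by simp

text \<open>A fusion argument. The node \<open>(t, u)\<close> carries the common beginning of all
  sequences with tag \<open>t\<close> whose branch passes through \<open>u\<close>. Only tags below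
  \<open>r\<close> are live at level \<open>r\<close>, so a level has finitely many nodes and
  finitely many requirements.\<close>

lemma mycielski_scheme:
  fixes D :: "nat \<Rightarrow> bool list list \<Rightarrow> bool" and s :: "nat \<Rightarrow> bool list"
  assumes dense: "\<And>d u. \<exists>u'. list_all2 prefix u u' \<and> D d u'"
    and mono: "\<forall>d u u'. D d u \<longrightarrow> list_all2 prefix u u' \<longrightarrow> D d u'"
  obtains \<phi> :: "nat \<Rightarrow> nat \<times> bool list \<Rightarrow> bool list" where
    "\<And>r t u. t < r \<Longrightarrow> length u = r \<Longrightarrow> prefix (s t) (\<phi> r (t, u))"
    "\<And>r t u. t < r \<Longrightarrow> length u = r \<Longrightarrow> r \<le> length (\<phi> r (t, u))"
    "\<And>r t u b. t < r \<Longrightarrow> length u = r \<Longrightarrow> prefix (\<phi> r (t, u)) (\<phi> (Suc r) (t, u @ [b]))"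
    "\<And>r d ns. d < r \<Longrightarrow> distinct ns \<Longrightarrow> set ns \<subseteq> {..<r} \<times> {u. length u = r} \<Longrightarrow> D d (map (\<phi> r) ns)"
proof -
  define P where "P = (\<lambda>r (\<phi> :: nat \<times> bool list \<Rightarrow> bool list).
     (\<forall>t<r. \<forall>u. length u = r \<longrightarrow> prefix (s t) (\<phi> (t, u)) \<and> r \<le> length (\<phi> (t, u))) \<and>
     (\<forall>d<r. \<forall>ns. distinct ns \<longrightarrow> set ns \<subseteq> {..<r} \<times> {u. length u = r} \<longrightarrow> D d (map \<phi> ns)))"
  define Q where "Q = (\<lambda>r (\<phi> :: nat \<times> bool list \<Rightarrow> bool list) \<phi>'.
     \<forall>t<r. \<forall>u. length u = r \<longrightarrow> (\<forall>b. prefix (\<phi> (t, u)) (\<phi>' (t, u @ [b]))))"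
  have "\<exists>\<phi>. \<forall>r. P r (\<phi> r) \<and> Q r (\<phi> r) (\<phi> (Suc r))"
  proof (rule dependent_nat_choice)
    show "\<exists>\<phi>. P 0 \<phi>" by (simp add: P_def)
  next
    fix \<phi> r
    assume P: "P r \<phi>"
    define N where "N = {..<Suc r} \<times> {u :: bool list. length u = Suc r}"
    have finN: "finite N" by (simp add: N_def finite_lists_of_length)
    \<comment> \<open>A live node inherits the word of its parent; the tag \<open>r\<close>, which
      becomes live at this level, starts from its prescribed word \<open>s r\<close>.\<close>
    define \<phi>0 where "\<phi>0 = (\<lambda>(t, u). if t < r then \<phi> (t, butlast u) else s t)"
    define R where "R = {..<Suc r} \<times> {ns. distinct ns \<and> set ns \<subseteq> N}"
    have "finite R"
      unfolding R_def
      using finite_subset_distinct[OF finN] by (auto simp: conj_commute)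
    from finite_requirements_extension[where D = D and \<phi> = \<phi>0, OF dense mono this]
    obtain \<phi>1 where 1: "\<And>a. prefix (\<phi>0 a) (\<phi>1 a)" "\<And>d ns. (d, ns) \<in> R \<Longrightarrow> D d (map \<phi>1 ns)"
      unfolding R_def by force
    \<comment> \<open>The padding forces the words along a branch to grow without bound.\<close>
    define \<phi>2 where "\<phi>2 = (\<lambda>a. \<phi>1 a @ replicate (Suc r) False)"
    have p2: "prefix (\<phi>0 a) (\<phi>2 a)" for a using 1(1)[of a] by (auto simp: \<phi>2_def prefix_def)
    have "P (Suc r) \<phi>2"
      unfolding P_def
    proof (intro conjI allI impI)
      fix t and u :: "bool list" assume t: "t < Suc r" and u: "length u = Suc r"
      have "prefix (s t) (\<phi>0 (t, u))"
        using t u P by (auto simp: \<phi>0_def P_def)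
      then show "prefix (s t) (\<phi>2 (t, u))" using p2 prefix_order.trans by blast
      show "Suc r \<le> length (\<phi>2 (t, u))" by (simp add: \<phi>2_def)
    next
      fix d ns
      assume "d < Suc r" "distinct ns" "set ns \<subseteq> {..<Suc r} \<times> {u :: bool list. length u = Suc r}"
      then have "D d (map \<phi>1 ns)" by (intro 1(2)) (auto simp: R_def N_def)
      then show "D d (map \<phi>2 ns)" by (rule mono[rule_format]) (auto simp: list_all2_conv_all_nth \<phi>2_def)
    qed
    moreover have "Q r \<phi> \<phi>2"
      unfolding Q_def
    proof (intro allI impI)
      fix t u b assume "t < r" "length (u :: bool list) = r"
      then show "prefix (\<phi> (t, u)) (\<phi>2 (t, u @ [b]))"
        using p2[of "(t, u @ [b])"] by (simp add: \<phi>0_def)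
    qed
    ultimately show "\<exists>\<phi>'. P (Suc r) \<phi>' \<and> Q r \<phi> \<phi>'" by blast
  qed
  then obtain \<phi> where "\<And>r. P r (\<phi> r)" "\<And>r. Q r (\<phi> r) (\<phi> (Suc r))" by blast
  then show ?thesis by (intro that[of \<phi>]) (auto simp: P_def Q_def)
qed

text \<open>The sequence \<open>\<psi> t w\<close> is the union of the words along the branch
  \<open>w\<close>. Finitely many distinct pairs pass through distinct live nodes from some level
  on, and a level beyond \<open>d\<close> has taken care of requirement \<open>d\<close> for all
  such nodes.\<close>

lemma mycielski:
  fixes D :: "nat \<Rightarrow> bool list list \<Rightarrow> bool" and s :: "nat \<Rightarrow> bool list"
  assumes dense: "\<And>d u. \<exists>u'. list_all2 prefix u u' \<and> D d u'"
    and mono: "\<forall>d u u'. D d u \<longrightarrow> list_all2 prefix u u' \<longrightarrow> D d u'"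
  obtains \<psi> :: "nat \<Rightarrow> (nat \<Rightarrow> bool) \<Rightarrow> nat \<Rightarrow> bool" where
    "\<And>t w b. b < length (s t) \<Longrightarrow> \<psi> t w b = s t ! b"
    "\<And>t b. \<exists>l. \<forall>w w'. (\<forall>m<l. w m = w' m) \<longrightarrow> \<psi> t w b = \<psi> t w' b"
    "\<And>d ns. distinct ns \<Longrightarrow> \<exists>l. D d (map (\<lambda>(t, w). map (\<psi> t w) [0..<l]) ns)"
proof -
  obtain \<phi> :: "nat \<Rightarrow> nat \<times> bool list \<Rightarrow> bool list" where
    \<phi>s: "\<And>r t u. t < r \<Longrightarrow> length u = r \<Longrightarrow> prefix (s t) (\<phi> r (t, u))" and
    \<phi>l: "\<And>r t u. t < r \<Longrightarrow> length u = r \<Longrightarrow> r \<le> length (\<phi> r (t, u))" and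
    \<phi>p: "\<And>r t u b. t < r \<Longrightarrow> length u = r \<Longrightarrow> prefix (\<phi> r (t, u)) (\<phi> (Suc r) (t, u @ [b]))" and
    \<phi>D: "\<And>r d ns. d < r \<Longrightarrow> distinct ns \<Longrightarrow> set ns \<subseteq> {..<r} \<times> {u. length u = r} \<Longrightarrow> D d (map (\<phi> r) ns)"
    using mycielski_scheme[where D = D and s = s, OF dense mono] by blast
  \<comment> \<open>Level \<open>Suc (t + b)\<close> is safe: there \<open>t\<close> is live and the
    word is longer than \<open>b\<close>.\<close>
  define \<psi> where "\<psi> = (\<lambda>t w b. \<phi> (Suc (t + b)) (t, map w [0..<Suc (t + b)]) ! b)"
  have chain: "prefix (\<phi> r (t, map w [0..<r])) (\<phi> r' (t, map w [0..<r']))" if "t < r" "r \<le> r'" for t w r r'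
    using that(2,1)
  proof (induction r' rule: dec_induct)
    case base then show ?case by simp
  next
    case (step r')
    have "prefix (\<phi> r' (t, map w [0..<r'])) (\<phi> (Suc r') (t, map w [0..<r'] @ [w r']))"
      using step by (intro \<phi>p) auto
    then show ?case using step by (auto intro: prefix_order.trans)
  qed
  have \<psi>: "\<psi> t w b = \<phi> r (t, map w [0..<r]) ! b" if "t < r" "b < length (\<phi> r (t, map w [0..<r]))" for t w b r
  proof -
    let ?r = "Suc (t + b)"
    have b: "b < length (\<phi> ?r (t, map w [0..<?r]))" using \<phi>l[of t ?r "map w [0..<?r]"] by simp
    show ?thesis
    proof (cases "r \<le> ?r")
      case True
      then show ?thesis using chain[OF that(1), of ?r w] that(2) b unfolding \<psi>_def
        by (auto simp: prefix_def nth_append)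
    next
      case False
      then show ?thesis using chain[of t ?r r w] that(2) b unfolding \<psi>_def
        by (auto simp: prefix_def nth_append)
    qed
  qed
  show ?thesis
  proof (rule that[of \<psi>])
    fix t w b assume "b < length (s t)"
    moreover have "prefix (s t) (\<phi> (Suc (t + b)) (t, map w [0..<Suc (t + b)]))" by (intro \<phi>s) auto
    ultimately show "\<psi> t w b = s t ! b" by (auto simp: \<psi>_def prefix_def nth_append)
  next
    fix t b
    show "\<exists>l. \<forall>w w'. (\<forall>m<l. w m = w' m) \<longrightarrow> \<psi> t w b = \<psi> t w' b"
    proof (intro exI[of _ "Suc (t + b)"] allI impI)
      fix w w' :: "nat \<Rightarrow> bool" assume "\<forall>m<Suc (t + b). w m = w' m"
      then have "map w [0..<Suc (t + b)] = map w' [0..<Suc (t + b)]" by (intro map_cong) auto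
      then show "\<psi> t w b = \<psi> t w' b" unfolding \<psi>_def by (simp only:)
    qed
  next
    fix d and ns :: "(nat \<times> (nat \<Rightarrow> bool)) list"
    assume dist: "distinct ns"
    let ?f = "\<lambda>r (t, w :: nat \<Rightarrow> bool). (t :: nat, map w [0..<r])"
    have ev1: "\<forall>\<^sub>F r in sequentially. \<forall>a\<in>set ns. \<forall>b\<in>set ns. a \<noteq> b \<longrightarrow> ?f r a \<noteq> ?f r b"
    proof (intro eventually_ball_finite ballI finite_set)
      fix a b assume "a \<in> set ns" "b \<in> set ns"
      obtain t w t' w' where ab: "a = (t, w)" "b = (t', w')" by (cases a, cases b) auto
      show "\<forall>\<^sub>F r in sequentially. a \<noteq> b \<longrightarrow> ?f r a \<noteq> ?f r b"
      proof (cases "w = w'")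
        case True then show ?thesis using ab by auto
      next
        case False
        then obtain m where m: "w m \<noteq> w' m" by auto
        have "?f r a \<noteq> ?f r b" if "r > m" for r
        proof
          assume "?f r a = ?f r b"
          then show False using m that ab by auto
        qed
        then show ?thesis by (intro eventually_mono[OF eventually_gt_at_top[of m]] impI)
      qed
    qed
    have ev2: "\<forall>\<^sub>F r in sequentially. \<forall>a\<in>set ns. fst a < r"
      by (intro eventually_ball_finite ballI finite_set eventually_gt_at_top)
    have ev: "\<exists>r. (\<forall>a\<in>set ns. \<forall>b\<in>set ns. a \<noteq> b \<longrightarrow> ?f r a \<noteq> ?f r b) \<and> (\<forall>a\<in>set ns. fst a < r) \<and> d < r"
      by (rule eventually_happens'[OF sequentially_bot eventually_conj[OF ev1 eventually_conj[OF ev2 eventually_gt_at_top]]])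
    obtain r where r: "\<forall>a\<in>set ns. \<forall>b\<in>set ns. a \<noteq> b \<longrightarrow> ?f r a \<noteq> ?f r b"
      "\<And>a. a \<in> set ns \<Longrightarrow> fst a < r" "d < r"
      using ev by (elim exE conjE) (erule that, auto)
    have "distinct (map (?f r) ns)"
      unfolding distinct_map inj_on_def using dist r(1) by metis
    moreover have "set (map (?f r) ns) \<subseteq> {..<r} \<times> {u. length u = r}" using r(2) by force
    ultimately have D: "D d (map (\<phi> r) (map (?f r) ns))" using r(3) by (intro \<phi>D)
    \<comment> \<open>Truncation at \<open>l\<close> covers every relevant word of level
      \<open>r\<close>, so the requirement passes upwards by monotonicity.\<close>
    define l where "l = Max (insert 0 ((\<lambda>a. length (\<phi> r (?f r a))) ` set ns))"
    have l: "length (\<phi> r (?f r a)) \<le> l" if "a \<in> set ns" for a using that by (auto simp: l_def intro!: Max_ge)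
    have "D d (map (\<lambda>(t, w). map (\<psi> t w) [0..<l]) ns)"
    proof (rule mono[rule_format, OF D])
      have "prefix (\<phi> r (?f r a)) ((\<lambda>(t, w). map (\<psi> t w) [0..<l]) a)" if a: "a \<in> set ns" for a
      proof -
        obtain t w where tw: "a = (t, w)" by fastforce
        let ?p = "\<phi> r (t, map w [0..<r])"
        have "map (\<psi> t w) [0..<length ?p] = ?p"
          using r(2)[OF a] tw by (intro nth_equalityI) (auto simp: \<psi>)
        moreover have "prefix (map (\<psi> t w) [0..<length ?p]) (map (\<psi> t w) [0..<l])"
          using l[OF a] tw by (intro prefix_map_upt) simp
        ultimately show ?thesis using tw by simp
      qed
      then show "list_all2 prefix (map (\<phi> r) (map (?f r) ns)) (map (\<lambda>(t, w). map (\<psi> t w) [0..<l]) ns)"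
        by (simp add: list_all2_conv_all_nth)
    qed
    then show "\<exists>l. D d (map (\<lambda>(t, w). map (\<psi> t w) [0..<l]) ns)" by blast
  qed
qed

section \<open>Names and links\<close>

type_synonym key = "nat \<times> bool list list"

text \<open>A tag packs a prefix for the row at sort 0, keys of names one sort higher, keys of names
  one sort lower, and a dummy number that makes the tags with given data unbounded. A key describes
  a name by its tag and the rows of a membership matrix.\<close>

definition tag_data :: "nat \<Rightarrow> bool list \<times> key list \<times> key list \<times> nat" where
  "tag_data = from_nat"

definition tag_prefix :: "nat \<Rightarrow> bool list" where
  "tag_prefix t = fst (tag_data t)"

definition tag_up :: "nat \<Rightarrow> key set" where
  "tag_up t = set (fst (snd (tag_data t)))"

definition tag_down :: "nat \<Rightarrow> key set" where
  "tag_down t = set (fst (snd (snd (tag_data t))))"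

lemma large_tag_exists:
  assumes "finite A" "finite B"
  obtains t where "t > N" "tag_prefix t = p" "tag_up t = A" "tag_down t = B"
proof -
  obtain as bs where ab: "set as = A" "set bs = B" using assms finite_list by metis
  let ?h = "\<lambda>m :: nat. to_nat (p, as, bs, m)"
  have "inj ?h" by (auto simp: inj_on_def)
  then have "infinite (range ?h)" by (rule range_inj_infinite)
  then obtain m where "?h m > N" by (auto simp: infinite_nat_iff_unbounded)
  then show ?thesis
    using ab by (intro that[of "?h m"]) (auto simp: tag_prefix_def tag_up_def tag_down_def tag_data_def)
qed

lemma finite_separating_set:
  assumes "finite K" "\<And>c c'. c \<in> K \<Longrightarrow> c' \<in> K \<Longrightarrow> c \<noteq> c' \<Longrightarrow> \<exists>a. (r c a :: bool) \<noteq> r c' a"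
  obtains A where "finite A" "\<And>ds. A \<subseteq> set ds \<Longrightarrow> inj_on (\<lambda>c. map (r c) ds) K"
proof -
  obtain h where h: "\<And>c c'. c \<in> K \<Longrightarrow> c' \<in> K \<Longrightarrow> c \<noteq> c' \<Longrightarrow> r c (h c c') \<noteq> r c' (h c c')"
    using assms(2) by metis
  show ?thesis
  proof (rule that[of "(\<lambda>(c, c'). h c c') ` (K \<times> K)"])
    show "finite ((\<lambda>(c, c'). h c c') ` (K \<times> K))" using assms(1) by auto
    show "inj_on (\<lambda>c. map (r c) ds) K" if "(\<lambda>(c, c'). h c c') ` (K \<times> K) \<subseteq> set ds" for ds
    proof (rule inj_onI, rule ccontr)
      fix c c' assume *: "c \<in> K" "c' \<in> K" "map (r c) ds = map (r c') ds" "c \<noteq> c'"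
      then have "h c c' \<in> set ds" using that by auto
      then have "r c (h c c') = r c' (h c c')" using *(3) by simp
      then show False using h * by blast
    qed
  qed
qed

lemma inj_on_key:
  assumes "inj_on f K" "\<And>t cs. (t, cs) \<in> P \<Longrightarrow> set cs \<subseteq> K"
  shows "inj_on (\<lambda>(t, cs). (t, map f cs)) P"
proof (rule inj_onI)
  fix u v assume uv: "u \<in> P" "v \<in> P" "(case u of (t, cs) \<Rightarrow> (t, map f cs)) = (case v of (t, cs) \<Rightarrow> (t, map f cs))"
  obtain t cs t' cs' where e: "u = (t, cs)" "v = (t', cs')" by fastforce
  then have "set cs \<subseteq> K" "set cs' \<subseteq> K" using uv assms(2) by auto
  then have "inj_on f (set cs \<union> set cs')" using assms(1) by (meson Un_least inj_on_subset)
  then show "u = v" using uv(3) e by (auto dest: map_inj_on)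
qed

text \<open>Classes live in a common type, so that classes of different points can be compared.
  \<open>sep\<close> and \<open>extensional\<close> are dual: they tell classes apart by elements
  one sort higher and one sort lower. \<open>extensional\<close> is asked across two points because
  names of \<open>x\<close> and \<open>x'\<close> have to be compared later.\<close>

locale tower =
  fixes cls :: "nat \<Rightarrow> 'x \<Rightarrow> 'o::countable \<Rightarrow> 'c"
    and mem :: "nat \<Rightarrow> 'c \<Rightarrow> 'c \<Rightarrow> bool"
    and rho :: "'c \<Rightarrow> nat \<Rightarrow> bool"
  assumes sep: "cls k x a \<noteq> cls k x a' \<Longrightarrow>
      \<exists>b. mem k (cls k x a) (cls (Suc k) x b) \<noteq> mem k (cls k x a') (cls (Suc k) x b)"
    and extensional: "range (cls k x) = range (cls k x') \<Longrightarrow> cls (Suc k) x b \<noteq> cls (Suc k) x' b' \<Longrightarrow>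
      \<exists>a. mem k (cls k x a) (cls (Suc k) x b) \<noteq> mem k (cls k x a) (cls (Suc k) x' b')"
    and rho_inj: "rho (cls 0 x a) = rho (cls 0 x' a') \<Longrightarrow> cls 0 x a = cls 0 x' a'"
begin

definition name_value :: "nat \<Rightarrow> 'x \<Rightarrow> 'o list \<times> nat \<Rightarrow> nat \<times> 'c list" where
  "name_value k x = (\<lambda>(os, t). (t, map (cls k x) os))"

text \<open>The name with the larger tag decides, ties going to the upper one. It recognises the
  other name by that name's tag and by one row for each class in that name's list, tested against
  the classes in its own list.\<close>

definition link :: "nat \<Rightarrow> nat \<times> 'c list \<Rightarrow> nat \<times> 'c list \<Rightarrow> bool" where
  "link k = (\<lambda>(t, cs) (t', cs').
     if t > t' then (t', map (\<lambda>c'. map (\<lambda>c. mem k c c') cs) cs') \<in> tag_up t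
     else (t, map (\<lambda>c. map (\<lambda>c'. mem k c c') cs') cs) \<in> tag_down t')"

text \<open>The list \<open>os\<close> is filled with test elements that separate all classes
  occurring in \<open>P\<close> and, likewise, in \<open>Q\<close>. Then distinct names in either
  set have distinct keys, so a tag above all of theirs can list exactly the keys of the names to be
  linked.\<close>

lemma new_name:
  assumes fin: "finite P" "finite Q"
    and sepP: "\<And>c c'. c \<in> (\<Union>v\<in>P. set (snd v)) \<Longrightarrow> c' \<in> (\<Union>v\<in>P. set (snd v)) \<Longrightarrow> c \<noteq> c' \<Longrightarrow>
                \<exists>a. mem k' c (cls k x a) \<noteq> mem k' c' (cls k x a)"
    and sepQ: "\<And>c c'. c \<in> (\<Union>v\<in>Q. set (snd v)) \<Longrightarrow> c' \<in> (\<Union>v\<in>Q. set (snd v)) \<Longrightarrow> c \<noteq> c' \<Longrightarrow>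
                \<exists>a. mem k (cls k x a) c \<noteq> mem k (cls k x a) c'"
  obtains os t where "t > B" "tag_prefix t = p"
    "\<And>v. v \<in> P \<Longrightarrow> link k' v (name_value k x (os, t)) = \<alpha> v"
    "\<And>v. v \<in> Q \<Longrightarrow> link k (name_value k x (os, t)) v = \<beta> v"
proof -
  define KP where "KP = (\<Union>v\<in>P. set (snd v))"
  define KQ where "KQ = (\<Union>v\<in>Q. set (snd v))"
  have finK: "finite KP" "finite KQ" using fin by (auto simp: KP_def KQ_def)
  obtain A1 where A1: "finite A1" "\<And>ds. A1 \<subseteq> set ds \<Longrightarrow> inj_on (\<lambda>c. map (\<lambda>a. mem k' c (cls k x a)) ds) KP"
    using finite_separating_set[of KP "\<lambda>c a. mem k' c (cls k x a)"] finK(1) sepP[folded KP_def] by auto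
  obtain A2 where A2: "finite A2" "\<And>ds. A2 \<subseteq> set ds \<Longrightarrow> inj_on (\<lambda>c. map (\<lambda>a. mem k (cls k x a) c) ds) KQ"
    using finite_separating_set[of KQ "\<lambda>c a. mem k (cls k x a) c"] finK(2) sepQ[folded KQ_def] by auto
  obtain os where os: "set os = A1 \<union> A2" using A1(1) A2(1) finite_list[of "A1 \<union> A2"] by auto
  define f where "f = (\<lambda>c. map (\<lambda>a. mem k' c (cls k x a)) os)"
  define g where "g = (\<lambda>c. map (\<lambda>a. mem k (cls k x a) c) os)"
  have inj: "inj_on f KP" "inj_on g KQ" using A1(2) A2(2) os unfolding f_def g_def by auto
  let ?f = "\<lambda>(t :: nat, cs). (t, map f cs)" and ?g = "\<lambda>(t :: nat, cs). (t, map g cs)"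
  have "set cs \<subseteq> KP" if "(t, cs) \<in> P" for t cs using that unfolding KP_def by force
  then have injf: "inj_on ?f P" by (rule inj_on_key[OF inj(1)])
  have "set cs \<subseteq> KQ" if "(t, cs) \<in> Q" for t cs using that unfolding KQ_def by force
  then have injg: "inj_on ?g Q" by (rule inj_on_key[OF inj(2)])
  define N where "N = Max (insert B (fst ` (P \<union> Q)))"
  have finN: "finite (insert B (fst ` (P \<union> Q)))" using fin by auto
  have N: "B \<le> N" "\<And>v. v \<in> P \<union> Q \<Longrightarrow> fst v \<le> N" unfolding N_def by (auto intro!: Max_ge[OF finN])
  obtain t where t: "t > N" "tag_prefix t = p" "tag_up t = ?g ` {v\<in>Q. \<beta> v}" "tag_down t = ?f ` {v\<in>P. \<alpha> v}"
    by (rule large_tag_exists[of "?g ` {v\<in>Q. \<beta> v}" "?f ` {v\<in>P. \<alpha> v}" N p]) (use fin in auto)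
  show ?thesis
  proof (rule that[of t os])
    show "t > B" "tag_prefix t = p" using t N by auto
  next
    fix v assume v: "v \<in> P"
    obtain t1 cs1 where v1: "v = (t1, cs1)" by fastforce
    have "\<not> t1 > t" using N(2)[of v] v v1 t(1) by auto
    then have "link k' v (name_value k x (os, t)) \<longleftrightarrow> ?f v \<in> tag_down t"
      by (simp add: link_def name_value_def v1 f_def comp_def)
    also have "\<dots> \<longleftrightarrow> \<alpha> v"
      unfolding t(4) using inj_on_image_mem_iff[OF injf v, of "{v\<in>P. \<alpha> v}"] v by auto
    finally show "link k' v (name_value k x (os, t)) = \<alpha> v" .
  next
    fix v assume v: "v \<in> Q"
    obtain t1 cs1 where v1: "v = (t1, cs1)" by fastforce
    have "t > t1" using N(2)[of v] v v1 t(1) by auto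
    then have "link k (name_value k x (os, t)) v \<longleftrightarrow> ?g v \<in> tag_up t"
      by (simp add: link_def name_value_def v1 g_def comp_def)
    also have "\<dots> \<longleftrightarrow> \<beta> v"
      unfolding t(3) using inj_on_image_mem_iff[OF injg v, of "{v\<in>Q. \<beta> v}"] v by auto
    finally show "link k (name_value k x (os, t)) v = \<beta> v" .
  qed
qed

end

section \<open>Finite conditions and generic sequences\<close>

text \<open>Coordinate \<open>(0, i, b)\<close> is bit \<open>b\<close> of the row of element
  \<open>i\<close> of sort 0; coordinate \<open>(Suc k, i, j)\<close> says whether element
  \<open>j\<close> of sort \<open>k\<close> belongs to element \<open>i\<close> of sort
  \<open>k + 1\<close>.\<close>

type_synonym cond = "nat \<times> nat \<times> nat \<Rightarrow> bool option"

definition compat :: "cond \<Rightarrow> cond \<Rightarrow> bool" where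
  "compat q m \<longleftrightarrow> (\<forall>c b b'. q c = Some b \<longrightarrow> m c = Some b' \<longrightarrow> b = b')"

lemma finite_map_eq_map_of:
  assumes "finite (dom q)"
  obtains l where "map_of l = q"
proof -
  obtain xs where xs: "set xs = dom q" using finite_list[OF assms] by blast
  have "map_of (map (\<lambda>a. (a, the (q a))) xs) = q"
    unfolding map_of_map_restrict xs by (rule ext) (auto simp: restrict_map_def dom_def)
  then show ?thesis using that by blast
qed

text \<open>The index \<open>None\<close> separates the two sequences of a pair; the index \<open>Some (r, l)\<close> asks that
  the rows at level 0 together with the remaining bits prescribed by \<open>l\<close> can be extended into \<open>U r\<close>.\<close>

definition row_requirement ::
    "(nat \<Rightarrow> cond \<Rightarrow> bool) \<Rightarrow> (nat \<times> ((nat \<times> nat \<times> nat) \<times> bool) list) option \<Rightarrow> bool list list \<Rightarrow> bool" where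
  "row_requirement U d u = (case d of
      None \<Rightarrow> length u = 2 \<longrightarrow> (\<exists>b<length (u ! 0). b < length (u ! 1) \<and> u ! 0 ! b \<noteq> u ! 1 ! b)
    | Some (r, l) \<Rightarrow> \<exists>q. finite (dom q) \<and> U r q \<and>
        (\<forall>k i j b b'. q (Suc k, i, j) = Some b \<longrightarrow> map_of l (Suc k, i, j) = Some b' \<longrightarrow> b = b') \<and>
        (\<forall>i<length u. \<forall>b c. q (0, i, b) = Some c \<longrightarrow> b < length (u ! i) \<and> u ! i ! b = c))"

lemma finite_cond_bound:
  assumes "finite (dom (q :: cond))"
  obtains L where "L > N" "\<And>a b c v. q (a, b, c) = Some v \<Longrightarrow> a < L \<and> b < L \<and> c < L"
proof -
  let ?S = "(\<lambda>(a, b, c). a + b + c) ` dom q"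
  define L where "L = Suc (Max (insert N ?S))"
  have f: "finite (insert N ?S)" using assms by auto
  show ?thesis
  proof (rule that[of L])
    show "L > N" unfolding L_def using Max_ge[OF f, of N] by auto
    fix a b c v assume "q (a, b, c) = Some v"
    then have "a + b + c \<in> ?S" by (force simp: dom_def)
    then have "a + b + c < L" unfolding L_def using Max_ge[OF f, of "a + b + c"] by auto
    then show "a < L \<and> b < L \<and> c < L" by auto
  qed
qed

lemma row_requirement_dense:
  assumes dense: "\<And>r q. finite (dom q) \<Longrightarrow> \<exists>q'. finite (dom q') \<and> q \<subseteq>\<^sub>m q' \<and> U r q'"
  shows "\<exists>u'. list_all2 prefix u u' \<and> row_requirement U d u'"
proof (cases d)
  case None
  show ?thesis
  proof (cases "length u = 2")
    case False
    then show ?thesis using None by (intro exI[of _ u]) (auto simp: row_requirement_def list_all2_conv_all_nth)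
  next
    case True
    then obtain a b where u: "u = [a, b]" by (auto simp: numeral_2_eq_2 length_Suc_conv)
    define N where "N = length a + length b"
    \<comment> \<open>Both padded words have length \<open>N + 1\<close>, and position
      \<open>N\<close> lies in both paddings.\<close>
    let ?a = "a @ replicate (Suc (length b)) False" and ?b = "b @ replicate (Suc (length a)) True"
    have "N < length ?a" "N < length ?b" "?a ! N \<noteq> ?b ! N" by (simp_all add: N_def nth_append del: replicate_Suc)
    then show ?thesis using None u by (intro exI[of _ "[?a, ?b]"]) (auto simp: row_requirement_def intro!: exI[of _ N])
  qed
next
  case (Some rl)
  obtain r l where rl: "rl = (r, l)" by fastforce
  \<comment> \<open>At level 0 only \<open>u\<close> counts; \<open>l\<close> is consulted for the
    links.\<close>
  define q0 :: cond where "q0 = (\<lambda>(a, i, b). if a = 0 then (if i < length u \<and> b < length (u ! i) then Some (u ! i ! b) else None)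
     else map_of l (a, i, b))"
  have "dom q0 \<subseteq> dom (map_of l) \<union> (\<lambda>(i, b). (0, i, b)) ` (SIGMA i:{..<length u}. {..<length (u ! i)})"
    by (auto simp: q0_def dom_def image_iff split: if_splits)
  then have "finite (dom q0)" by (rule finite_subset) (simp add: finite_dom_map_of)
  from dense[OF this, of r] obtain q where q: "finite (dom q)" "q0 \<subseteq>\<^sub>m q" "U r q" by blast
  obtain L where "L > 0" and L: "\<And>a b c v. q (a, b, c) = Some v \<Longrightarrow> a < L \<and> b < L \<and> c < L"
    by (rule finite_cond_bound[OF q(1), of 0]) (rule that)
  have ext: "q c = Some v" if "q0 c = Some v" for c v
    using q(2) that by (metis domI map_le_def)
  \<comment> \<open>Rows are read off \<open>q\<close> with \<open>False\<close> for undecided bits,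
    and are long enough to contain every bit that \<open>q\<close> decides in them.\<close>
  define u' where "u' = map (\<lambda>i. map (\<lambda>b. q (0, i, b) = Some True) [0..<max L (length (u ! i))]) [0..<length u]"
  have "prefix (u ! i) (u' ! i)" if i: "i < length u" for i
  proof -
    have "u ! i = map (\<lambda>b. q (0, i, b) = Some True) [0..<length (u ! i)]"
    proof (rule nth_equalityI)
      fix b assume b: "b < length (u ! i)"
      then have "q0 (0, i, b) = Some (u ! i ! b)" using i by (simp add: q0_def)
      then have "q (0, i, b) = Some (u ! i ! b)" by (rule ext)
      then show "u ! i ! b = map (\<lambda>b. q (0, i, b) = Some True) [0..<length (u ! i)] ! b" using b by simp
    qed simp
    also have "prefix \<dots> (u' ! i)"
      using i unfolding u'_def by (simp add: prefix_map_upt)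
    finally show ?thesis .
  qed
  then have "list_all2 prefix u u'" by (auto simp: list_all2_conv_all_nth u'_def)
  moreover have "row_requirement U d u'"
    unfolding row_requirement_def Some rl option.case prod.case
  proof (intro exI[of _ q] conjI allI impI)
    fix k i j b b' assume "q (Suc k, i, j) = Some b" "map_of l (Suc k, i, j) = Some b'"
    then show "b = b'" using ext[of "(Suc k, i, j)" b'] by (simp add: q0_def)
  next
    fix i b c assume "i < length u'" "q (0, i, b) = Some c"
    then show "b < length (u' ! i)" using L[of 0 i b c] by (simp add: u'_def less_max_iff_disj)
  next
    fix i b c assume "i < length u'" "q (0, i, b) = Some c"
    then show "u' ! i ! b = c" using L[of 0 i b c] by (simp add: u'_def less_max_iff_disj)
  qed (use q in auto)
  ultimately show ?thesis by blast
qed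

lemma row_requirement_mono:
  assumes "row_requirement U d u" "list_all2 prefix u u'"
  shows "row_requirement U d u'"
proof -
  have len: "length u' = length u" using assms(2) by (simp add: list_all2_conv_all_nth)
  have pre: "b < length (u' ! i) \<and> u' ! i ! b = u ! i ! b" if "i < length u" "b < length (u ! i)" for i b
  proof -
    have "prefix (u ! i) (u' ! i)" using assms(2) that(1) by (simp add: list_all2_conv_all_nth)
    then show ?thesis using that(2) by (auto simp: prefix_def nth_append)
  qed
  show ?thesis
  proof (cases d)
    case None
    show ?thesis
      unfolding row_requirement_def None option.case
    proof
      assume 2: "length u' = 2"
      then obtain b where b: "b < length (u ! 0)" "b < length (u ! 1)" "u ! 0 ! b \<noteq> u ! 1 ! b"
        using assms(1) len unfolding row_requirement_def None by auto
      then show "\<exists>b<length (u' ! 0). b < length (u' ! 1) \<and> u' ! 0 ! b \<noteq> u' ! 1 ! b"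
        using pre[OF _ b(1)] pre[OF _ b(2)] 2 len by (intro exI[of _ b]) fastforce
    qed
  next
    case (Some rl)
    obtain r l where rl: "rl = (r, l)" by fastforce
    obtain q where q: "finite (dom q)" "U r q"
      "\<forall>k i j b b'. q (Suc k, i, j) = Some b \<longrightarrow> map_of l (Suc k, i, j) = Some b' \<longrightarrow> b = b'"
      "\<forall>i<length u. \<forall>b c. q (0, i, b) = Some c \<longrightarrow> b < length (u ! i) \<and> u ! i ! b = c"
      using assms(1) unfolding row_requirement_def Some rl option.case prod.case by (elim exE conjE) (rule that)
    have "\<forall>i<length u'. \<forall>b c. q (0, i, b) = Some c \<longrightarrow> b < length (u' ! i) \<and> u' ! i ! b = c"
      using q(4) pre unfolding len by metis
    then show ?thesis
      unfolding row_requirement_def Some rl option.case prod.case using q(1,2,3) by (intro exI[of _ q] conjI)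
  qed
qed

text \<open>The last clause is genericity in the form needed later: rows are complete, links are
  decided only finitely, and some condition in \<open>U r\<close> agrees with both. It holds for
  every finite \<open>m\<close> because there are only countably many, each giving a requirement of
  its own. Injectivity is the requirement \<open>None\<close>.\<close>

lemma generic_sequences:
  fixes U :: "nat \<Rightarrow> cond \<Rightarrow> bool"
  assumes dense: "\<And>r q. finite (dom q) \<Longrightarrow> \<exists>q'. finite (dom q') \<and> q \<subseteq>\<^sub>m q' \<and> U r q'"
  obtains \<psi> :: "nat \<Rightarrow> (nat \<Rightarrow> bool) \<Rightarrow> nat \<Rightarrow> bool" where
    "\<And>t w b. b < length (s t) \<Longrightarrow> \<psi> t w b = s t ! b"
    "\<And>t b. \<exists>l. \<forall>w w'. (\<forall>m<l. w m = w' m) \<longrightarrow> \<psi> t w b = \<psi> t w' b"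
    "\<And>t w t' w'. \<psi> t w = \<psi> t' w' \<Longrightarrow> t = t' \<and> w = w'"
    "\<And>m ns r. finite (dom m) \<Longrightarrow> distinct ns \<Longrightarrow> \<exists>q. finite (dom q) \<and> U r q \<and>
        (\<forall>k i j b b'. q (Suc k, i, j) = Some b \<longrightarrow> m (Suc k, i, j) = Some b' \<longrightarrow> b = b') \<and>
        (\<forall>i<length ns. \<forall>b c. q (0, i, b) = Some c \<longrightarrow> \<psi> (fst (ns ! i)) (snd (ns ! i)) b = c)"
proof -
  define D where "D = (\<lambda>d. row_requirement U (from_nat d))"
  have mono: "\<forall>d u u'. D d u \<longrightarrow> list_all2 prefix u u' \<longrightarrow> D d u'"
    unfolding D_def using row_requirement_mono by blast
  have D: "\<exists>u'. list_all2 prefix u u' \<and> D d u'" for d u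
    unfolding D_def using row_requirement_dense[where U = U] dense by blast
  obtain \<psi> :: "nat \<Rightarrow> (nat \<Rightarrow> bool) \<Rightarrow> nat \<Rightarrow> bool" where \<psi>:
    "\<And>t w b. b < length (s t) \<Longrightarrow> \<psi> t w b = s t ! b"
    "\<And>t b. \<exists>l. \<forall>w w'. (\<forall>m<l. w m = w' m) \<longrightarrow> \<psi> t w b = \<psi> t w' b"
    "\<And>d ns. distinct ns \<Longrightarrow> \<exists>l. D d (map (\<lambda>(t, w). map (\<psi> t w) [0..<l]) ns)"
    using mycielski[where D = D and s = s, OF D mono] by blast
  have req: "\<exists>l. row_requirement U d (map (\<lambda>(t, w). map (\<psi> t w) [0..<l]) ns)" if "distinct ns" for d ns
    using \<psi>(3)[OF that, of "to_nat d"] by (simp add: D_def)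
  show ?thesis
  proof (rule that[of \<psi>])
    fix t w t' w' assume eq: "\<psi> t w = \<psi> t' w'"
    show "t = t' \<and> w = w'"
    proof (rule ccontr)
      assume "\<not> (t = t' \<and> w = w')"
      then have "distinct [(t, w), (t', w')]" by auto
      from req[OF this, of None] show False using eq by (auto simp: row_requirement_def)
    qed
  next
    fix m :: cond and ns :: "(nat \<times> (nat \<Rightarrow> bool)) list" and r
    assume m: "finite (dom m)" and ns: "distinct ns"
    obtain l where l: "map_of l = m" using finite_map_eq_map_of[OF m] by blast
    obtain L where "row_requirement U (Some (r, l)) (map (\<lambda>(t, w). map (\<psi> t w) [0..<L]) ns)"
      using req[OF ns] by blast
    then obtain q where q: "finite (dom q)" "U r q"
      "\<forall>k i j b b'. q (Suc k, i, j) = Some b \<longrightarrow> m (Suc k, i, j) = Some b' \<longrightarrow> b = b'"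
      "\<forall>i<length ns. \<forall>b c. q (0, i, b) = Some c \<longrightarrow>
          b < length (map (\<lambda>(t, w). map (\<psi> t w) [0..<L]) ns ! i) \<and> map (\<lambda>(t, w). map (\<psi> t w) [0..<L]) ns ! i ! b = c"
      unfolding row_requirement_def option.case prod.case l length_map by (elim exE conjE) (rule that)
    have "\<psi> (fst (ns ! i)) (snd (ns ! i)) b = c" if "i < length ns" "q (0, i, b) = Some c" for i b c
      using q(4)[rule_format, OF that] that(1) by (auto simp: case_prod_beta)
    then show "\<exists>q. finite (dom q) \<and> U r q \<and>
        (\<forall>k i j b b'. q (Suc k, i, j) = Some b \<longrightarrow> m (Suc k, i, j) = Some b' \<longrightarrow> b = b') \<and>
        (\<forall>i<length ns. \<forall>b c. q (0, i, b) = Some c \<longrightarrow> \<psi> (fst (ns ! i)) (snd (ns ! i)) b = c)"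
      using q(1,2,3) by (intro exI[of _ q] conjI) auto
  qed (use \<psi> in auto)
qed

section \<open>Generic enumerations of the names\<close>

text \<open>A stage of the enumeration is one list with entries of all sorts; the position inside a
  sort is the index used in the code.\<close>

definition sort_part :: "nat \<Rightarrow> (nat \<times> 'n) list \<Rightarrow> 'n list" where
  "sort_part k \<sigma> = map snd (filter (\<lambda>e. fst e = k) \<sigma>)"

lemma sort_part_append: "sort_part k (\<sigma> @ \<tau>) = sort_part k \<sigma> @ sort_part k \<tau>"
  by (simp add: sort_part_def)

lemma sort_part_single: "sort_part k [(k', \<nu>)] = (if k' = k then [\<nu>] else [])"
  by (simp add: sort_part_def)

lemma length_sort_part: "length (sort_part k \<tau>) = length (filter (\<lambda>k'. k' = k) (map fst \<tau>))"
  by (simp add: sort_part_def filter_map comp_def)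

lemma length_sort_part_le: "length (sort_part k \<tau>) \<le> length \<tau>"
  by (simp add: sort_part_def)

lemma length_filter_concat_replicate:
  "length (filter P (concat (replicate n xs))) = n * length (filter P xs)"
  by (induction n) auto

locale generic_tower = tower cls mem rho
  for cls :: "nat \<Rightarrow> 'x \<Rightarrow> 'o::countable \<Rightarrow> 'c"
    and mem :: "nat \<Rightarrow> 'c \<Rightarrow> 'c \<Rightarrow> bool"
    and rho :: "'c \<Rightarrow> nat \<Rightarrow> bool" +
  fixes U :: "nat \<Rightarrow> cond \<Rightarrow> bool" and \<psi> :: "nat \<Rightarrow> (nat \<Rightarrow> bool) \<Rightarrow> nat \<Rightarrow> bool" and p :: cond
  assumes psi_prefix: "b < length (tag_prefix t) \<Longrightarrow> \<psi> t w b = tag_prefix t ! b"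
    and psi_local: "\<exists>l. \<forall>w w'. (\<forall>m<l. w m = w' m) \<longrightarrow> \<psi> t w b = \<psi> t w' b"
    and psi_inj: "\<psi> t w = \<psi> t' w' \<Longrightarrow> t = t' \<and> w = w'"
    and psi_generic: "finite (dom m) \<Longrightarrow> distinct ns \<Longrightarrow> \<exists>q. finite (dom q) \<and> U r q \<and>
        (\<forall>k i j b b'. q (Suc k, i, j) = Some b \<longrightarrow> m (Suc k, i, j) = Some b' \<longrightarrow> b = b') \<and>
        (\<forall>i<length ns. \<forall>b c. q (0, i, b) = Some c \<longrightarrow> \<psi> (fst (ns ! i)) (snd (ns ! i)) b = c)"
    and finite_p: "finite (dom p)"
begin

text \<open>Bit \<open>(a, 0)\<close> records that position \<open>a\<close> exists, which makes the
  length recoverable; the bits \<open>(a, Suc b)\<close> copy \<open>rho\<close>.\<close>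

definition list_code :: "'c list \<Rightarrow> nat \<Rightarrow> bool" where
  "list_code cs m = (let a = fst (prod_decode m); b = snd (prod_decode m) in
     a < length cs \<and> (b = 0 \<or> rho (cs ! a) (b - 1)))"

definition label :: "nat \<times> 'c list \<Rightarrow> nat \<Rightarrow> bool" where
  "label v = \<psi> (fst v) (list_code (snd v))"

lemma list_code_inj:
  assumes "list_code (map (cls 0 x) os) = list_code (map (cls 0 x') os')"
  shows "map (cls 0 x) os = map (cls 0 x') os'"
proof -
  have "a < length os \<longleftrightarrow> a < length os'" for a
    using fun_cong[OF assms, of "prod_encode (a, 0)"] by (simp add: list_code_def)
  then have len: "length os = length os'" by (meson linorder_neqE_nat nat_less_le)
  have "cls 0 x (os ! i) = cls 0 x' (os' ! i)" if i: "i < length os" for i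
  proof (rule rho_inj, rule ext)
    fix b show "rho (cls 0 x (os ! i)) b = rho (cls 0 x' (os' ! i)) b"
      using fun_cong[OF assms, of "prod_encode (i, Suc b)"] i len by (simp add: list_code_def)
  qed
  then show ?thesis using len by (intro nth_equalityI) auto
qed

lemma label_inj:
  assumes "label (name_value 0 x \<nu>) = label (name_value 0 x' \<nu>')"
  shows "name_value 0 x \<nu> = name_value 0 x' \<nu>'"
  using psi_inj[OF assms[unfolded label_def]] list_code_inj
  by (auto simp: name_value_def split: prod.splits)

text \<open>A row of sort 0 is decided in full as soon as its name is listed; a link is decided once
  both names are.\<close>

definition state_bits :: "'x \<Rightarrow> (nat \<times> 'o list \<times> nat) list \<Rightarrow> cond" where
  "state_bits x \<sigma> = (\<lambda>(k, i, j). case k of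
      0 \<Rightarrow> if i < length (sort_part 0 \<sigma>) then Some (label (name_value 0 x (sort_part 0 \<sigma> ! i)) j) else None
    | Suc k' \<Rightarrow> if i < length (sort_part (Suc k') \<sigma>) \<and> j < length (sort_part k' \<sigma>)
        then Some (link k' (name_value k' x (sort_part k' \<sigma> ! j)) (name_value (Suc k') x (sort_part (Suc k') \<sigma> ! i))) else None)"

lemma state_bits_0: "state_bits x \<sigma> (0, i, j) = (if i < length (sort_part 0 \<sigma>) then Some (label (name_value 0 x (sort_part 0 \<sigma> ! i)) j) else None)"
  by (simp add: state_bits_def)

lemma state_bits_Suc: "state_bits x \<sigma> (Suc k, i, j) = (if i < length (sort_part (Suc k) \<sigma>) \<and> j < length (sort_part k \<sigma>)
        then Some (link k (name_value k x (sort_part k \<sigma> ! j)) (name_value (Suc k) x (sort_part (Suc k) \<sigma> ! i))) else None)"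
  by (simp add: state_bits_def)

lemma state_bits_append: "state_bits x \<sigma> \<subseteq>\<^sub>m state_bits x (\<sigma> @ \<tau>)"
proof -
  have "state_bits x (\<sigma> @ \<tau>) (k, i, j) = Some v" if "state_bits x \<sigma> (k, i, j) = Some v" for k i j v
    using that by (cases k) (auto simp: state_bits_0 state_bits_Suc sort_part_append nth_append split: if_splits)
  then show ?thesis by (auto simp: map_le_def dom_def)
qed

text \<open>Needed for \<open>psi_generic\<close>: two equal rows are not generic to each
  other.\<close>

definition good :: "'x \<Rightarrow> (nat \<times> 'o list \<times> nat) list \<Rightarrow> bool" where
  "good x \<sigma> \<longleftrightarrow> (\<forall>k. distinct (map (name_value k x) (sort_part k \<sigma>)))"

lemma good_Nil: "good x []"
  by (simp add: good_def sort_part_def)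

lemma good_snoc:
  assumes "good x \<sigma>" "name_value k x \<nu> \<notin> name_value k x ` set (sort_part k \<sigma>)"
  shows "good x (\<sigma> @ [(k, \<nu>)])"
  using assms by (auto simp: good_def sort_part_append sort_part_single)

text \<open>Every demand of \<open>q\<close> on the new index concerns either the row, met by the
  prefix in the tag, or links to names already listed, met by \<open>new_name\<close>. So a name of
  any sort can be added without losing compatibility.\<close>

lemma add_one:
  assumes good: "good x \<sigma>" and comp: "compat q (state_bits x \<sigma>)" and fin: "finite (dom q)"
  shows "\<exists>\<nu>. good x (\<sigma> @ [(k, \<nu>)]) \<and> compat q (state_bits x (\<sigma> @ [(k, \<nu>)]))"
proof -
  define vs where "vs = (\<lambda>k. map (name_value k x) (sort_part k \<sigma>))"
  have dist: "distinct (vs k)" for k using good by (simp add: vs_def good_def)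
  define n0 where "n0 = length (sort_part k \<sigma>)"
  define P where "P = (if k = 0 then {} else set (vs (k - 1)))"
  define Q where "Q = set (vs (Suc k))"
  \<comment> \<open>Links on which \<open>q\<close> is silent are set to \<open>False\<close>.
    Values within a sort are distinct, so \<open>v\<close> determines its index.\<close>
  define \<alpha> where "\<alpha> = (\<lambda>v. \<exists>j<length (vs (k - 1)). vs (k - 1) ! j = v \<and> q (k, n0, j) = Some True)"
  define \<beta> where "\<beta> = (\<lambda>v. \<exists>i<length (vs (Suc k)). vs (Suc k) ! i = v \<and> q (Suc k, i, n0) = Some True)"
  obtain L where "L > 0" and L: "\<And>a b c v. q (a, b, c) = Some v \<Longrightarrow> a < L \<and> b < L \<and> c < L"
    by (rule finite_cond_bound[OF fin, of 0]) (rule that)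
  \<comment> \<open>All bits that \<open>q\<close> can ask of row \<open>n0\<close> lie below
    \<open>L\<close>, hence inside the prefix \<open>s\<close>.\<close>
  define s where "s = map (\<lambda>b. q (0, n0, b) = Some True) [0..<L]"
  \<comment> \<open>A tag above \<open>B\<close> makes the new value differ from all listed values
    of sort \<open>k\<close>.\<close>
  define B where "B = Max (insert 0 (fst ` set (vs k)))"
  have B: "fst v \<le> B" if "v \<in> set (vs k)" for v
    unfolding B_def by (rule Max_ge) (use that in auto)
  have clsvs: "\<exists>a. c = cls k' x a" if "v \<in> set (vs k')" "c \<in> set (snd v)" for v c k'
    using that by (auto simp: vs_def name_value_def)
  obtain os t where t: "t > B" "tag_prefix t = s"
    "\<And>v. v \<in> P \<Longrightarrow> link (k - 1) v (name_value k x (os, t)) = \<alpha> v"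
    "\<And>v. v \<in> Q \<Longrightarrow> link k (name_value k x (os, t)) v = \<beta> v"
  proof (rule new_name[of P Q "k - 1" k x B s \<alpha> \<beta>])
    show "finite P" "finite Q" by (auto simp: P_def Q_def)
  next
    fix c c' assume *: "c \<in> (\<Union>v\<in>P. set (snd v))" "c' \<in> (\<Union>v\<in>P. set (snd v))" "c \<noteq> c'"
    then obtain k' where k': "k = Suc k'" by (cases k) (auto simp: P_def)
    have "\<exists>a. c = cls k' x a" "\<exists>a. c' = cls k' x a" using * clsvs[of _ k'] k' by (auto simp: P_def)
    then show "\<exists>a. mem (k - 1) c (cls k x a) \<noteq> mem (k - 1) c' (cls k x a)"
      using sep[of k' x] *(3) k' by auto
  next
    fix c c' assume *: "c \<in> (\<Union>v\<in>Q. set (snd v))" "c' \<in> (\<Union>v\<in>Q. set (snd v))" "c \<noteq> c'"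
    have "\<exists>a. c = cls (Suc k) x a" "\<exists>a. c' = cls (Suc k) x a" using * clsvs[of _ "Suc k"] by (auto simp: Q_def)
    then show "\<exists>a. mem k (cls k x a) c \<noteq> mem k (cls k x a) c'"
      using extensional[of k x x] *(3) by auto
  qed (rule that)
  let ?\<nu> = "(os, t)"
  let ?\<sigma> = "\<sigma> @ [(k, ?\<nu>)]"
  have new: "name_value k x ?\<nu> \<notin> name_value k x ` set (sort_part k \<sigma>)"
  proof
    assume "name_value k x ?\<nu> \<in> name_value k x ` set (sort_part k \<sigma>)"
    then have "name_value k x ?\<nu> \<in> set (vs k)" by (simp add: vs_def)
    from B[OF this] t(1) show False by (simp add: name_value_def)
  qed
  have "b = b'" if q: "q (\<kappa>, i, j) = Some b" and b': "state_bits x ?\<sigma> (\<kappa>, i, j) = Some b'" for \<kappa> i j b b'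
  proof (cases "state_bits x \<sigma> (\<kappa>, i, j)")
    case (Some b'')
    then have "state_bits x ?\<sigma> (\<kappa>, i, j) = Some b''" using state_bits_append[of x \<sigma> "[(k, ?\<nu>)]"] unfolding map_le_def by (metis domI)
    then show ?thesis using q b' Some comp by (auto simp: compat_def)
  next
    case None
    show ?thesis
    proof (cases \<kappa>)
      case 0
      then have "k = 0" "i = n0"
        using None b' by (auto simp: state_bits_0 sort_part_append sort_part_single n0_def split: if_splits)
      then have "b' = label (name_value 0 x ?\<nu>) j" using b' 0 by (simp add: state_bits_0 sort_part_append sort_part_single n0_def)
      also have "\<dots> = s ! j"
        using L[OF q] by (simp add: label_def name_value_def psi_prefix t(2)) (simp add: s_def psi_prefix t(2))
      also have "\<dots> = b" using L[OF q] q 0 \<open>i = n0\<close> by (simp add: s_def)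
      finally show ?thesis by simp
    next
      case (Suc \<kappa>')
      have ij: "i < length (sort_part (Suc \<kappa>') ?\<sigma>)" "j < length (sort_part \<kappa>' ?\<sigma>)"
        using b' Suc by (auto simp: state_bits_Suc split: if_splits)
      have b'': "b' = link \<kappa>' (name_value \<kappa>' x (sort_part \<kappa>' ?\<sigma> ! j)) (name_value (Suc \<kappa>') x (sort_part (Suc \<kappa>') ?\<sigma> ! i))"
        using b' Suc ij by (simp add: state_bits_Suc)
      have "\<not> (i < length (sort_part (Suc \<kappa>') \<sigma>) \<and> j < length (sort_part \<kappa>' \<sigma>))"
        using None Suc by (auto simp: state_bits_Suc split: if_splits)
      then consider "k = Suc \<kappa>'" "i = n0" "j < length (sort_part \<kappa>' \<sigma>)" | "k = \<kappa>'" "j = n0" "i < length (sort_part (Suc \<kappa>') \<sigma>)"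
        using ij by (auto simp: sort_part_append sort_part_single n0_def split: if_splits)
      then show ?thesis
      proof cases
        case 1
        let ?v = "vs \<kappa>' ! j"
        have v: "?v \<in> set (vs \<kappa>')" using 1 by (simp add: vs_def)
        have "b' = link \<kappa>' ?v (name_value k x ?\<nu>)"
          using b'' 1 by (simp add: sort_part_append sort_part_single nth_append n0_def vs_def)
        also have "\<dots> = \<alpha> ?v" using t(3)[of ?v] v 1 by (simp add: P_def)
        also have "\<dots> \<longleftrightarrow> q (k, n0, j) = Some True"
          using 1 nth_eq_iff_index_eq[OF dist[of \<kappa>']] by (auto simp: \<alpha>_def vs_def)
        finally show ?thesis using q 1 Suc by auto
      next
        case 2
        let ?v = "vs (Suc k) ! i"
        have v: "?v \<in> set (vs (Suc k))" using 2 by (simp add: vs_def)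
        have "b' = link k (name_value k x ?\<nu>) ?v"
          using b'' 2 by (simp add: sort_part_append sort_part_single nth_append n0_def vs_def)
        also have "\<dots> = \<beta> ?v" using t(4)[of ?v] v by (simp add: Q_def)
        also have "\<dots> \<longleftrightarrow> q (Suc k, i, n0) = Some True"
          using 2 nth_eq_iff_index_eq[OF dist[of "Suc k"]] by (auto simp: \<beta>_def vs_def)
        finally show ?thesis using q 2 Suc by auto
      qed
    qed
  qed
  then have "compat q (state_bits x ?\<sigma>)" by (auto simp: compat_def)
  then show ?thesis using good_snoc[OF good new] by blast
qed

lemma add_list:
  assumes "finite (dom q)" "good x \<sigma>" "compat q (state_bits x \<sigma>)"
  shows "\<exists>\<tau>. map fst \<tau> = ks \<and> good x (\<sigma> @ \<tau>) \<and> compat q (state_bits x (\<sigma> @ \<tau>))"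
  using assms(2,3)
proof (induction ks arbitrary: \<sigma>)
  case Nil then show ?case by auto
next
  case (Cons k ks)
  obtain \<nu> where \<nu>: "good x (\<sigma> @ [(k, \<nu>)])" "compat q (state_bits x (\<sigma> @ [(k, \<nu>)]))"
    using add_one[OF Cons.prems assms(1)] by blast
  from Cons.IH[OF this] obtain \<tau> where "map fst \<tau> = ks" "good x ((\<sigma> @ [(k, \<nu>)]) @ \<tau>)" "compat q (state_bits x ((\<sigma> @ [(k, \<nu>)]) @ \<tau>))"
    by blast
  then show ?case by (intro exI[of _ "(k, \<nu>) # \<tau>"]) auto
qed

text \<open>Compatibility turns into extension as soon as every coordinate in the domain of
  \<open>q\<close> is decided, which happens once the sorts concerned are long enough.\<close>

lemma realize:
  assumes "finite (dom q)" "good x \<sigma>" "compat q (state_bits x \<sigma>)"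
  shows "\<exists>\<tau>. good x (\<sigma> @ \<tau>) \<and> q \<subseteq>\<^sub>m state_bits x (\<sigma> @ \<tau>) \<and> (\<forall>k\<le>N. N < length (sort_part k (\<sigma> @ \<tau>)))"
proof -
  obtain L where N: "L > N" and L: "\<And>a b c v. q (a, b, c) = Some v \<Longrightarrow> a < L \<and> b < L \<and> c < L"
    by (rule finite_cond_bound[OF assms(1), of N]) (rule that)
  \<comment> \<open>This list of sorts asks for \<open>L\<close> new names in each of the sorts
    below \<open>L\<close>.\<close>
  obtain \<tau> where \<tau>: "map fst \<tau> = concat (replicate L [0..<L])" "good x (\<sigma> @ \<tau>)" "compat q (state_bits x (\<sigma> @ \<tau>))"
    using add_list[OF assms, of "concat (replicate L [0..<L])"] by blast
  have len: "L \<le> length (sort_part k (\<sigma> @ \<tau>))" if "k < L" for k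
  proof -
    have "filter (\<lambda>k'. k' = k) [0..<L] \<noteq> []" using that by (auto simp: filter_empty_conv)
    then have "1 \<le> length (filter (\<lambda>k'. k' = k) [0..<L])" by (simp add: Suc_le_eq)
    then have "L * 1 \<le> length (sort_part k \<tau>)"
      unfolding length_sort_part \<tau>(1) length_filter_concat_replicate by (intro mult_le_mono) auto
    then show ?thesis by (simp add: sort_part_append)
  qed
  have "state_bits x (\<sigma> @ \<tau>) (k, i, j) = Some b" if q: "q (k, i, j) = Some b" for k i j b
  proof -
    have "state_bits x (\<sigma> @ \<tau>) (k, i, j) \<noteq> None"
      using L[OF q] len[of k] len[of "k - 1"] by (cases k) (auto simp: state_bits_0 state_bits_Suc)
    then obtain b' where b': "state_bits x (\<sigma> @ \<tau>) (k, i, j) = Some b'" by auto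
    then have "b = b'" using \<tau>(3)[unfolded compat_def, rule_format, OF q] by simp
    then show ?thesis using b' by simp
  qed
  then have "q \<subseteq>\<^sub>m state_bits x (\<sigma> @ \<tau>)" by (auto simp: map_le_def dom_def)
  moreover have "\<forall>k\<le>N. N < length (sort_part k (\<sigma> @ \<tau>))" using len N by (meson le_less_trans less_le_trans)
  ultimately show ?thesis using \<tau>(2) by blast
qed

lemma meet:
  assumes "good x \<sigma>"
  shows "\<exists>q. finite (dom q) \<and> U r q \<and> compat q (state_bits x \<sigma>)"
proof -
  \<comment> \<open>Level 0 is cut off because it may be infinite; the Mycielski family takes care
    of it, and only the links decided so far are fed in as a finite map.\<close>
  define m :: cond where "m = state_bits x \<sigma> |` {c. fst c \<noteq> 0}"
  have "dom m \<subseteq> fst ` set \<sigma> \<times> {..<length \<sigma>} \<times> {..<length \<sigma>}"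
  proof
    fix c assume c: "c \<in> dom m"
    obtain k i j where kij: "c = (Suc k, i, j)"
      using c by (cases c, cases "fst c") (auto simp: m_def restrict_map_def split: if_splits)
    then have ij: "i < length (sort_part (Suc k) \<sigma>)" "j < length (sort_part k \<sigma>)"
      using c by (auto simp: m_def restrict_map_def state_bits_Suc split: if_splits)
    have "sort_part (Suc k) \<sigma> \<noteq> []" using ij by auto
    then have "Suc k \<in> fst ` set \<sigma>" by (force simp: sort_part_def filter_empty_conv)
    then show "c \<in> fst ` set \<sigma> \<times> {..<length \<sigma>} \<times> {..<length \<sigma>}"
      using kij ij length_sort_part_le[of "Suc k" \<sigma>] length_sort_part_le[of k \<sigma>] by auto
  qed
  then have fin: "finite (dom m)" by (rule finite_subset) auto
  define f where "f = (\<lambda>v. (fst v, list_code (snd v :: 'c list)) :: nat \<times> (nat \<Rightarrow> bool))"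
  define ns where "ns = map f (map (name_value 0 x) (sort_part 0 \<sigma>))"
  have "inj_on f (range (name_value 0 x))"
    by (rule inj_onI) (auto simp: f_def name_value_def dest: list_code_inj)
  then have "inj_on f (set (map (name_value 0 x) (sort_part 0 \<sigma>)))" by (rule inj_on_subset) auto
  then have "distinct ns"
    unfolding ns_def distinct_map[of f] using assms unfolding good_def by blast
  from psi_generic[OF fin this, of r] obtain q where q: "finite (dom q)" "U r q"
    "\<forall>k i j b b'. q (Suc k, i, j) = Some b \<longrightarrow> m (Suc k, i, j) = Some b' \<longrightarrow> b = b'"
    "\<forall>i<length ns. \<forall>b c. q (0, i, b) = Some c \<longrightarrow> \<psi> (fst (ns ! i)) (snd (ns ! i)) b = c"
    by (elim exE conjE) (rule that)
  have "b = b'" if *: "q (k, i, j) = Some b" "state_bits x \<sigma> (k, i, j) = Some b'" for k i j b b'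
  proof (cases k)
    case 0
    then have i: "i < length (sort_part 0 \<sigma>)" and b': "b' = label (name_value 0 x (sort_part 0 \<sigma> ! i)) j"
      using *(2) by (auto simp: state_bits_0 split: if_splits)
    have "\<psi> (fst (ns ! i)) (snd (ns ! i)) j = b" using q(4) i *(1) 0 by (simp add: ns_def)
    then show ?thesis using i b' by (simp add: ns_def f_def label_def)
  next
    case (Suc k')
    then have "m (Suc k', i, j) = Some b'" using *(2) by (simp add: m_def restrict_map_def)
    then show ?thesis using q(3) *(1) Suc by auto
  qed
  then have "compat q (state_bits x \<sigma>)" by (auto simp: compat_def)
  then show ?thesis using q by blast
qed

text \<open>Besides dense set \<open>r\<close>, the bookkeeping makes every index defined eventually
  and lists name number \<open>r\<close> up to equality of values. The condition is written as
  \<open>map_of l\<close> so that the quantifier runs over a countable type, which keeps the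
  predicate measurable.\<close>

definition meets :: "'x \<Rightarrow> nat \<Rightarrow> (nat \<times> 'o list \<times> nat) list \<Rightarrow> bool" where
  "meets x r \<sigma> \<longleftrightarrow> good x \<sigma> \<and> (\<exists>l. U r (map_of l) \<and> map_of l \<subseteq>\<^sub>m state_bits x \<sigma>) \<and>
     (\<forall>k\<le>r. r < length (sort_part k \<sigma>)) \<and>
     (case from_nat r of (k, \<nu>) \<Rightarrow> name_value k x \<nu> \<in> name_value k x ` set (sort_part k \<sigma>))"

lemma meets_exists:
  assumes "good x \<sigma>"
  shows "\<exists>\<tau>. meets x r (\<sigma> @ \<tau>)"
proof -
  obtain k :: nat and \<nu> :: "'o list \<times> nat" where r: "from_nat r = (k, \<nu>)"
    by (cases "from_nat r :: nat \<times> 'o list \<times> nat") auto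
  obtain \<tau>1 where \<tau>1: "good x (\<sigma> @ \<tau>1)" "name_value k x \<nu> \<in> name_value k x ` set (sort_part k (\<sigma> @ \<tau>1))"
  proof (cases "name_value k x \<nu> \<in> name_value k x ` set (sort_part k \<sigma>)")
    case True then show ?thesis using that[of "[]"] assms by simp
  next
    case False then show ?thesis
      using that[of "[(k, \<nu>)]"] good_snoc[OF assms] by (simp add: sort_part_append sort_part_single)
  qed
  obtain q where q: "finite (dom q)" "U r q" "compat q (state_bits x (\<sigma> @ \<tau>1))" using meet[OF \<tau>1(1)] by blast
  obtain \<tau>2 where \<tau>2: "good x ((\<sigma> @ \<tau>1) @ \<tau>2)" "q \<subseteq>\<^sub>m state_bits x ((\<sigma> @ \<tau>1) @ \<tau>2)"
     "\<forall>k\<le>r. r < length (sort_part k ((\<sigma> @ \<tau>1) @ \<tau>2))"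
    using realize[OF q(1) \<tau>1(1) q(3)] by blast
  obtain l where "map_of l = q" using finite_map_eq_map_of[OF q(1)] by blast
  then have "meets x r (\<sigma> @ \<tau>1 @ \<tau>2)"
    using \<tau>2 q(2) \<tau>1(2) unfolding meets_def r by (auto simp: sort_part_append)
  then show ?thesis by blast
qed

lemma initial_exists: "\<exists>\<sigma>. good x \<sigma> \<and> p \<subseteq>\<^sub>m state_bits x \<sigma>"
proof -
  have "state_bits x [] (k, i, j) = None" for k i j by (cases k) (auto simp: state_bits_0 state_bits_Suc sort_part_def)
  then have "compat p (state_bits x [])" by (auto simp: compat_def)
  from realize[OF finite_p good_Nil this] show ?thesis by auto
qed

end

section \<open>Decoding bits into points of the iterated jumps\<close>

text \<open>Base 3 makes the coding injective: the tail after the first difference is at most half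
  of the differing term.\<close>

definition real_of_bits :: "(nat \<Rightarrow> bool) \<Rightarrow> real" where
  "real_of_bits b = (\<Sum>m. of_bool (b m) * (1/3) ^ m)"

lemma summable_bits: "summable (\<lambda>m. of_bool (b m) * (1/3 :: real) ^ m)"
  by (rule summable_comparison_test[OF _ summable_geometric[of "1/3 :: real"]]) auto

lemma real_of_bits_nonneg: "0 \<le> real_of_bits b"
  unfolding real_of_bits_def by (rule suminf_nonneg[OF summable_bits]) auto

lemma real_of_bits_less:
  assumes "\<And>i. i < m \<Longrightarrow> b i = b' i" "b m" "\<not> b' m"
  shows "real_of_bits b' < real_of_bits b"
proof -
  define f where "f = (\<lambda>i. of_bool (b i) * (1/3 :: real) ^ i - of_bool (b' i) * (1/3) ^ i)"
  have sf: "summable f" unfolding f_def by (intro summable_diff summable_bits)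
  have "real_of_bits b - real_of_bits b' = suminf f"
    unfolding real_of_bits_def f_def by (rule suminf_diff[OF summable_bits summable_bits])
  also have "\<dots> = (\<Sum>i. f (i + Suc m)) + sum f {..<Suc m}"
    by (rule suminf_split_initial_segment[OF sf])
  also have "sum f {..<Suc m} = (1/3) ^ m"
  proof -
    have "sum f {..<m} = 0" by (rule sum.neutral) (auto simp: f_def assms(1))
    then show ?thesis by (simp add: f_def assms)
  qed
  finally have eq: "real_of_bits b - real_of_bits b' = (\<Sum>i. f (i + Suc m)) + (1/3) ^ m" .
  define h where "h = (\<lambda>i. (1/3 :: real) ^ Suc m * (1/3) ^ i)"
  have h: "h sums ((1/3) ^ Suc m * (1 / (1 - 1/3)))"
    unfolding h_def by (intro sums_mult geometric_sums) auto
  have "- h i \<le> f (i + Suc m)" for i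
  proof -
    have "h i = (1/3) ^ (i + Suc m)" by (simp add: h_def power_add)
    moreover have "0 \<le> h i" by (simp add: h_def)
    ultimately show ?thesis by (simp add: f_def of_bool_def)
  qed
  then have "suminf (\<lambda>i. - h i) \<le> (\<Sum>i. f (i + Suc m))"
    using h summable_ignore_initial_segment[OF sf, of "Suc m"]
    by (intro suminf_le) (simp_all add: summable_minus sums_iff)
  moreover have "suminf (\<lambda>i. - h i) = - ((1/3) ^ m / 2)"
    using h by (simp add: suminf_minus sums_iff)
  ultimately have "real_of_bits b - real_of_bits b' \<ge> (1/3) ^ m / 2" using eq by simp
  moreover have "(1/3 :: real) ^ m / 2 > 0" by simp
  ultimately show ?thesis by linarith
qed

lemma real_of_bits_eq_iff: "real_of_bits b = real_of_bits b' \<longleftrightarrow> b = b'"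
proof (rule iffI, rule ccontr)
  assume eq: "real_of_bits b = real_of_bits b'" and ne: "b \<noteq> b'"
  define m where "m = (LEAST m. b m \<noteq> b' m)"
  have "\<exists>m. b m \<noteq> b' m" using ne by auto
  then have m: "b m \<noteq> b' m" unfolding m_def by (rule LeastI_ex)
  have lt: "b i = b' i" if "i < m" for i using not_less_Least that unfolding m_def by blast
  show False
    using real_of_bits_less[of m b b'] real_of_bits_less[of m b' b] m lt eq by (cases "b m") auto
qed auto

text \<open>On lists of length \<open>k\<close>, the function
  \<open>\<lambda>s. decode_bits g (i # s)\<close> is element \<open>i\<close> of sort
  \<open>k\<close> as a point of the domain of the \<open>k\<close>-th jump; so on lists of length
  \<open>k + 1\<close> the whole function enumerates sort \<open>k\<close>. A non-member is replaced
  by the constant -1, a value that no row of sort 0 takes.\<close>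

fun decode_bits :: "(nat \<times> nat \<times> nat \<Rightarrow> bool) \<Rightarrow> nat list \<Rightarrow> real" where
  "decode_bits g [] = 0"
| "decode_bits g [i] = real_of_bits (\<lambda>b. g (0, i, b))"
| "decode_bits g (i # j # s) = (if g (Suc (length s), i, j) then decode_bits g (j # s) else - 1)"

lemma FS_eq_fin_refl: "FS_eq_fin k x x"
  by (induction k arbitrary: x) auto

lemma FS_eq_fin_sym: "FS_eq_fin k x y \<Longrightarrow> FS_eq_fin k y x"
  by (induction k arbitrary: x y) (auto, meson+)

lemma FS_eq_fin_trans: "FS_eq_fin k x y \<Longrightarrow> FS_eq_fin k y z \<Longrightarrow> FS_eq_fin k x z"
proof (induction k arbitrary: x y z)
  case (Suc k)
  show ?case
    unfolding FS_eq_fin.simps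
  proof (intro conjI allI)
    fix i
    obtain j where "FS_eq_fin k (FS_component x i) (FS_component y j)" using Suc.prems(1) by auto
    moreover obtain l where "FS_eq_fin k (FS_component y j) (FS_component z l)" using Suc.prems(2) by auto
    ultimately show "\<exists>l. FS_eq_fin k (FS_component x i) (FS_component z l)" using Suc.IH by blast
  next
    fix l
    obtain j where "FS_eq_fin k (FS_component y j) (FS_component z l)" using Suc.prems(2) by auto
    moreover obtain i where "FS_eq_fin k (FS_component x i) (FS_component y j)" using Suc.prems(1) by auto
    ultimately show "\<exists>i. FS_eq_fin k (FS_component x i) (FS_component z l)" using Suc.IH by blast
  qed
qed simp

lemma FS_eq_fin_cong:
  assumes "\<And>s. length s = k \<Longrightarrow> x s = x' s" "\<And>s. length s = k \<Longrightarrow> y s = y' s"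
  shows "FS_eq_fin k x y \<longleftrightarrow> FS_eq_fin k x' y'"
  using assms
proof (induction k arbitrary: x x' y y')
  case (Suc k)
  have "FS_eq_fin k (FS_component x i) (FS_component y j) \<longleftrightarrow> FS_eq_fin k (FS_component x' i) (FS_component y' j)" for i j
    by (rule Suc.IH) (auto simp: FS_component_def Suc.prems)
  then show ?case by simp
qed auto

lemma decode_bits_component_eq:
  "FS_eq_fin k (FS_component (\<lambda>s. decode_bits g (i # s)) j) y \<longleftrightarrow>
   FS_eq_fin k (if g (Suc k, i, j) then (\<lambda>s. decode_bits g (j # s)) else (\<lambda>_. - 1)) y"
  by (rule FS_eq_fin_cong) (auto simp: FS_component_def)

lemma decode_bits_component_eq_right:
  "FS_eq_fin k y (FS_component (\<lambda>s. decode_bits g (i # s)) j) \<longleftrightarrow>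
   FS_eq_fin k y (if g (Suc k, i, j) then (\<lambda>s. decode_bits g (j # s)) else (\<lambda>_. - 1))"
  by (rule FS_eq_fin_cong) (auto simp: FS_component_def)

text \<open>Nonemptiness leads from each set down to sort 0, where values are nonnegative; thus the
  filler is never mistaken for an element.\<close>

lemma decode_bits_not_eq_minus_one:
  assumes "\<And>k i. \<exists>j. g (Suc k, i, j)"
  shows "\<not> FS_eq_fin k (\<lambda>s. decode_bits g (i # s)) (\<lambda>_. - 1)"
proof (induction k arbitrary: i)
  case 0
  show ?case using real_of_bits_nonneg[of "\<lambda>b. g (0, i, b)"] by simp
next
  case (Suc k)
  obtain j where j: "g (Suc k, i, j)" using assms by blast
  have "\<not> FS_eq_fin k (FS_component (\<lambda>s. decode_bits g (i # s)) j) (FS_component (\<lambda>_. - 1) l)" for l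
    unfolding decode_bits_component_eq using j Suc.IH[of j] by (simp add: FS_component_def)
  then show ?case by auto
qed

lemma decode_bits_eq_Suc:
  assumes "\<And>k i. \<exists>j. g (Suc k, i, j)" "\<And>k i. \<exists>j. g' (Suc k, i, j)"
  defines "C \<equiv> \<lambda>k i i' j j'. (g (Suc k, i, j) \<and> g' (Suc k, i', j') \<and> FS_eq_fin k (\<lambda>s. decode_bits g (j # s)) (\<lambda>s. decode_bits g' (j' # s))) \<or>
     (\<not> g (Suc k, i, j) \<and> \<not> g' (Suc k, i', j'))"
  shows "FS_eq_fin (Suc k) (\<lambda>s. decode_bits g (i # s)) (\<lambda>s. decode_bits g' (i' # s)) \<longleftrightarrow>
     (\<forall>j. \<exists>j'. C k i i' j j') \<and> (\<forall>j'. \<exists>j. C k i i' j j')"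
proof -
  have "FS_eq_fin k (FS_component (\<lambda>s. decode_bits g (i # s)) j) (FS_component (\<lambda>s. decode_bits g' (i' # s)) j') \<longleftrightarrow> C k i i' j j'" for j j'
    unfolding decode_bits_component_eq decode_bits_component_eq_right C_def
    using decode_bits_not_eq_minus_one[of g k j, OF assms(1)] decode_bits_not_eq_minus_one[of g' k j', OF assms(2)] FS_eq_fin_sym[of k] FS_eq_fin_refl[of k]
    by auto
  then show ?thesis by simp
qed

lemma decode_bits_eq_top:
  "FS_eq_fin (Suc k) (decode_bits g) (decode_bits g') \<longleftrightarrow>
     (\<forall>i. \<exists>i'. FS_eq_fin k (\<lambda>s. decode_bits g (i # s)) (\<lambda>s. decode_bits g' (i' # s))) \<and>
     (\<forall>i'. \<exists>i. FS_eq_fin k (\<lambda>s. decode_bits g (i # s)) (\<lambda>s. decode_bits g' (i' # s)))"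
  by (simp add: FS_component_def)

section \<open>The generic structure attached to a point\<close>

text \<open>Passes from matching of indices to comparison of sets of values, where the enumeration
  no longer matters.\<close>

lemma range_correspondence:
  "(\<forall>j. A (a j) \<longrightarrow> (\<exists>j'. B (b j') \<and> a j = b j')) \<and> (\<forall>j'. B (b j') \<longrightarrow> (\<exists>j. A (a j) \<and> a j = b j')) \<longleftrightarrow>
   (\<forall>v\<in>range a. A v \<longrightarrow> v \<in> range b \<and> B v) \<and> (\<forall>v\<in>range b. B v \<longrightarrow> v \<in> range a \<and> A v)"
  by (simp add: image_iff) metis

lemma (in tower) new_name_ex:
  assumes "finite P" "finite Q"
    and "\<And>c c'. c \<in> (\<Union>v\<in>P. set (snd v)) \<Longrightarrow> c' \<in> (\<Union>v\<in>P. set (snd v)) \<Longrightarrow> c \<noteq> c' \<Longrightarrow>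
                \<exists>a. mem k' c (cls k x a) \<noteq> mem k' c' (cls k x a)"
    and "\<And>c c'. c \<in> (\<Union>v\<in>Q. set (snd v)) \<Longrightarrow> c' \<in> (\<Union>v\<in>Q. set (snd v)) \<Longrightarrow> c \<noteq> c' \<Longrightarrow>
                \<exists>a. mem k (cls k x a) c \<noteq> mem k (cls k x a) c'"
  shows "\<exists>u\<in>range (name_value k x). (\<forall>v\<in>P. link k' v u = \<alpha> v) \<and> (\<forall>v\<in>Q. link k u v = \<beta> v)"
proof (rule new_name[of P Q k' k x 0 "[]" \<alpha> \<beta>])
  fix os t
  assume "\<And>v. v \<in> P \<Longrightarrow> link k' v (name_value k x (os, t)) = \<alpha> v" "\<And>v. v \<in> Q \<Longrightarrow> link k (name_value k x (os, t)) v = \<beta> v"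
  then show ?thesis by (intro bexI[of _ "name_value k x (os, t)"]) auto
qed (use assms in auto)

context generic_tower
begin

text \<open>Taking the least code at each stage makes the choice measurable in
  \<open>x\<close>.\<close>

primrec state :: "'x \<Rightarrow> nat \<Rightarrow> (nat \<times> 'o list \<times> nat) list" where
  "state x 0 = from_nat (LEAST m. good x (from_nat m) \<and> p \<subseteq>\<^sub>m state_bits x (from_nat m))"
| "state x (Suc r) = state x r @ from_nat (LEAST m. meets x r (state x r @ from_nat m))"

lemma state_0: "good x (state x 0) \<and> p \<subseteq>\<^sub>m state_bits x (state x 0)"
proof -
  obtain \<sigma> where "good x \<sigma> \<and> p \<subseteq>\<^sub>m state_bits x \<sigma>" using initial_exists by blast
  then have "good x (from_nat (to_nat \<sigma>)) \<and> p \<subseteq>\<^sub>m state_bits x (from_nat (to_nat \<sigma>))" by simp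
  then show ?thesis unfolding state.simps by (rule LeastI)
qed

lemma state_Suc_if_good:
  assumes "good x (state x r)"
  shows "meets x r (state x (Suc r))"
proof -
  obtain \<tau> where "meets x r (state x r @ \<tau>)" using meets_exists[OF assms] by blast
  then have "meets x r (state x r @ from_nat (to_nat \<tau>))" by simp
  then show ?thesis unfolding state.simps by (rule LeastI)
qed

lemma state_good: "good x (state x r)"
  by (induction r) (use state_0 state_Suc_if_good in \<open>auto simp: meets_def\<close>)

lemma state_meets: "meets x r (state x (Suc r))"
  by (rule state_Suc_if_good[OF state_good])

lemma state_extends:
  assumes "r \<le> r'"
  obtains \<tau> where "state x r' = state x r @ \<tau>"
proof -
  have "\<exists>\<tau>. state x r' = state x r @ \<tau>"
    using assms by (induction r' rule: dec_induct) auto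
  then show ?thesis using that by blast
qed

lemma length_sort_part_st: "k \<le> r \<Longrightarrow> i \<le> r \<Longrightarrow> i < length (sort_part k (state x (Suc r)))"
  using state_meets[of x r] unfolding meets_def by (meson le_less_trans)

text \<open>Stage \<open>Suc (k + i)\<close> has met requirement \<open>k + i\<close>, hence has an
  entry \<open>i\<close> in sort \<open>k\<close>; later stages keep it.\<close>

definition name_at :: "'x \<Rightarrow> nat \<Rightarrow> nat \<Rightarrow> 'o list \<times> nat" where
  "name_at x k i = sort_part k (state x (Suc (k + i))) ! i"

lemma sort_part_st_nth:
  assumes "i < length (sort_part k (state x r))"
  shows "sort_part k (state x r) ! i = name_at x k i"
proof -
  have i: "i < length (sort_part k (state x (Suc (k + i))))" by (rule length_sort_part_st) auto
  show ?thesis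
  proof (cases "r \<le> Suc (k + i)")
    case True
    then obtain \<tau> where "state x (Suc (k + i)) = state x r @ \<tau>" using state_extends by blast
    then show ?thesis using assms by (simp add: name_at_def sort_part_append nth_append)
  next
    case False
    then obtain \<tau> where "state x r = state x (Suc (k + i)) @ \<tau>" using state_extends[of "Suc (k + i)" r] by auto
    then show ?thesis using i by (simp add: name_at_def sort_part_append nth_append del: state.simps)
  qed
qed

definition value_at :: "'x \<Rightarrow> nat \<Rightarrow> nat \<Rightarrow> nat \<times> 'c list" where
  "value_at x k i = name_value k x (name_at x k i)"

text \<open>The stage that treats the number coding \<open>(k, \<nu>)\<close> lists this name up to
  equality of values. So the set of values is independent of the choices made.\<close>

lemma range_value_at: "range (value_at x k) = range (name_value k x)"
proof
  show "range (value_at x k) \<subseteq> range (name_value k x)" by (auto simp: value_at_def)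
  show "range (name_value k x) \<subseteq> range (value_at x k)"
  proof
    fix v assume "v \<in> range (name_value k x)"
    then obtain \<nu> where v: "v = name_value k x \<nu>" by blast
    define r where "r = to_nat (k, \<nu>)"
    have "name_value k x \<nu> \<in> name_value k x ` set (sort_part k (state x (Suc r)))"
      using state_meets[of x r] unfolding meets_def r_def by simp
    then obtain i where i: "i < length (sort_part k (state x (Suc r)))" "name_value k x \<nu> = name_value k x (sort_part k (state x (Suc r)) ! i)"
      by (auto simp: in_set_conv_nth simp del: state.simps)
    then have "v = value_at x k i" unfolding value_at_def v using sort_part_st_nth[OF i(1)] by metis
    then show "v \<in> range (value_at x k)" by blast
  qed
qed

definition generic_bits :: "'x \<Rightarrow> nat \<times> nat \<times> nat \<Rightarrow> bool" where
  "generic_bits x = (\<lambda>(k, i, j). case k of 0 \<Rightarrow> label (value_at x 0 i) j | Suc k' \<Rightarrow> link k' (value_at x k' j) (value_at x (Suc k') i))"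

lemma generic_bits_0: "generic_bits x (0, i, j) = label (value_at x 0 i) j"
  by (simp add: generic_bits_def)

lemma generic_bits_Suc: "generic_bits x (Suc k, i, j) = link k (value_at x k j) (value_at x (Suc k) i)"
  by (simp add: generic_bits_def)

lemma state_bits_generic_bits:
  assumes "state_bits x (state x r) c = Some b"
  shows "generic_bits x c = b"
proof -
  obtain k i j where c: "c = (k, i, j)" by (cases c) auto
  show ?thesis
    using assms unfolding c
    by (cases k) (auto simp: state_bits_0 state_bits_Suc generic_bits_0 generic_bits_Suc value_at_def sort_part_st_nth split: if_splits)
qed

lemma generic_bits_p: "p c = Some b \<Longrightarrow> generic_bits x c = b"
  using state_0[of x] state_bits_generic_bits[of x 0 c b] unfolding map_le_def by (metis domI)

lemma generic_bits_generic: "\<exists>q. U r q \<and> (\<forall>c b. q c = Some b \<longrightarrow> generic_bits x c = b)"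
proof -
  obtain l where l: "U r (map_of l)" "map_of l \<subseteq>\<^sub>m state_bits x (state x (Suc r))"
    using state_meets[of x r] unfolding meets_def by blast
  have "generic_bits x c = b" if "map_of l c = Some b" for c b
    by (rule state_bits_generic_bits[of x "Suc r"]) (use l(2) that in \<open>metis domI map_le_def\<close>)
  then show ?thesis using l(1) by blast
qed

lemma range_name_value: "range (name_value k x) = UNIV \<times> lists (range (cls k x))"
proof -
  have "range (name_value k x) = UNIV \<times> (map (cls k x) ` UNIV)"
    by (auto simp: name_value_def image_iff)
  also have "map (cls k x) ` UNIV = lists (range (cls k x))" by (simp add: lists_image)
  finally show ?thesis .
qed

lemma range_name_value_eq_iff: "range (name_value k x) = range (name_value k x') \<longleftrightarrow> range (cls k x) = range (cls k x')"
proof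
  assume eq: "range (name_value k x) = range (name_value k x')"
  have "c \<in> range (cls k x) \<longleftrightarrow> (0, [c]) \<in> range (name_value k x)" for c x unfolding range_name_value by auto
  then show "range (cls k x) = range (cls k x')" using eq by blast
qed (simp add: range_name_value)

text \<open>A name of sort \<open>k\<close> can be linked to \<open>e\<close> and not to
  \<open>e'\<close> once the classes in their lists are separated by elements of \<open>x\<close>.
  Since the ranges at sort \<open>k\<close> agree, \<open>extensional\<close> across the two points
  supplies these.\<close>

lemma link_separates:
  assumes rg: "range (cls k x) = range (cls k x')"
    and e: "e \<in> range (name_value (Suc k) x)" "e' \<in> range (name_value (Suc k) x')" "e \<noteq> e'"
  shows "\<exists>v \<in> range (name_value k x). link k v e \<noteq> link k v e'"
proof -
  have "\<exists>a. mem k (cls k x a) c \<noteq> mem k (cls k x a) c'"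
    if c: "c \<in> (\<Union>v\<in>{e, e'}. set (snd v))" "c' \<in> (\<Union>v\<in>{e, e'}. set (snd v))" "c \<noteq> c'" for c c'
  proof -
    have mem: "\<exists>y b. y \<in> {x, x'} \<and> d = cls (Suc k) y b" if "d \<in> (\<Union>v\<in>{e, e'}. set (snd v))" for d
      using that e(1,2) by (auto simp: name_value_def) blast+
    obtain y b where y: "y \<in> {x, x'}" "c = cls (Suc k) y b" using mem[OF c(1)] by blast
    obtain y' b' where y': "y' \<in> {x, x'}" "c' = cls (Suc k) y' b'" using mem[OF c(2)] by blast
    have "range (cls k y) = range (cls k y')" using rg y y' by auto
    from extensional[OF this] obtain a where a: "mem k (cls k y a) c \<noteq> mem k (cls k y a) c'"
      using c(3) y y' by blast
    have "cls k y a \<in> range (cls k x)" using rg y by auto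
    then show ?thesis using a by auto
  qed
  then show ?thesis
    using new_name_ex[of "{}" "{e, e'}" 0 k x "\<lambda>_. True" "\<lambda>v. v = e"] e(3) by auto
qed

text \<open>With \<open>b = True\<close> this gives a member, with \<open>b = False\<close> a
  non-member; the decoding needs both.\<close>

lemma link_to_ex: "e \<in> range (name_value (Suc k) x) \<Longrightarrow> \<exists>v \<in> range (name_value k x). link k v e = b"
proof -
  assume e: "e \<in> range (name_value (Suc k) x)"
  have sep: "\<exists>a. mem k (cls k x a) c \<noteq> mem k (cls k x a) c'"
    if c: "c \<in> (\<Union>v\<in>{e}. set (snd v))" "c' \<in> (\<Union>v\<in>{e}. set (snd v))" "c \<noteq> c'" for c c'
    using extensional[of k x x] that e by (auto simp: name_value_def)
  then show ?thesis
    using new_name_ex[of "{}" "{e}" 0 k x "\<lambda>_. True" "\<lambda>v. b"] by auto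
qed

lemma link_from_ex: "v \<in> range (name_value k x) \<Longrightarrow> \<exists>e \<in> range (name_value (Suc k) x). link k v e"
proof -
  assume v: "v \<in> range (name_value k x)"
  have sep: "\<exists>a. mem k c (cls (Suc k) x a) \<noteq> mem k c' (cls (Suc k) x a)"
    if c: "c \<in> (\<Union>u\<in>{v}. set (snd u))" "c' \<in> (\<Union>u\<in>{v}. set (snd u))" "c \<noteq> c'" for c c'
    using sep[of k x] that v by (auto simp: name_value_def)
  then show ?thesis
    using new_name_ex[of "{v}" "{}" k "Suc k" x "\<lambda>_. True" "\<lambda>v. True"] by auto
qed

lemma generic_bits_mem_ex: "\<exists>j. generic_bits x (Suc k, i, j) = b"
proof -
  have "value_at x (Suc k) i \<in> range (name_value (Suc k) x)" by (simp add: value_at_def)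
  from link_to_ex[OF this, of b] show ?thesis
    unfolding range_value_at[symmetric] by (auto simp: generic_bits_Suc)
qed

lemma generic_bits_superset_ex: "\<exists>i. generic_bits x (Suc k, i, j)"
proof -
  have "value_at x k j \<in> range (name_value k x)" by (simp add: value_at_def)
  from link_from_ex[OF this] show ?thesis
    unfolding range_value_at[symmetric] by (auto simp: generic_bits_Suc)
qed

section \<open>Matching of decoded elements\<close>

definition elem_match :: "nat \<Rightarrow> 'x \<Rightarrow> 'x \<Rightarrow> nat \<Rightarrow> nat \<Rightarrow> bool" where
  "elem_match k x x' i i' \<longleftrightarrow> FS_eq_fin k (\<lambda>s. decode_bits (generic_bits x) (i # s)) (\<lambda>s. decode_bits (generic_bits x') (i' # s))"

text \<open>Every decoded set has members and non-members, so the filler occurs on both sides and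
  cancels out.\<close>

lemma elem_match_Suc: "elem_match (Suc k) x x' i i' \<longleftrightarrow>
    (\<forall>j. generic_bits x (Suc k, i, j) \<longrightarrow> (\<exists>j'. generic_bits x' (Suc k, i', j') \<and> elem_match k x x' j j')) \<and>
    (\<forall>j'. generic_bits x' (Suc k, i', j') \<longrightarrow> (\<exists>j. generic_bits x (Suc k, i, j) \<and> elem_match k x x' j j'))"
proof -
  have 1: "\<exists>j. generic_bits x (Suc k, i, j)" for x k i using generic_bits_mem_ex[of x k i True] by simp
  obtain a where a: "\<not> generic_bits x (Suc k, i, a)" using generic_bits_mem_ex[of x k i False] by auto
  obtain a' where a': "\<not> generic_bits x' (Suc k, i', a')" using generic_bits_mem_ex[of x' k i' False] by auto
  show ?thesis
    unfolding elem_match_def decode_bits_eq_Suc[of "generic_bits x" "generic_bits x'", OF 1 1] using a a' by blast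
qed

text \<open>As the lower sorts agree, both values are tested against the same set of names below,
  and distinct values are told apart by \<open>link_separates\<close>. At sort 0 the label
  determines the name.\<close>

lemma elem_match_iff:
  assumes "\<And>j. j < k \<Longrightarrow> range (cls j x) = range (cls j x')"
  shows "elem_match k x x' i i' \<longleftrightarrow> value_at x k i = value_at x' k i'"
  using assms
proof (induction k arbitrary: i i')
  case 0
  have "elem_match 0 x x' i i' \<longleftrightarrow> (\<lambda>b. generic_bits x (0, i, b)) = (\<lambda>b. generic_bits x' (0, i', b))"
    by (simp add: elem_match_def real_of_bits_eq_iff)
  also have "\<dots> \<longleftrightarrow> label (value_at x 0 i) = label (value_at x' 0 i')" unfolding generic_bits_0 by simp
  also have "\<dots> \<longleftrightarrow> value_at x 0 i = value_at x' 0 i'" unfolding value_at_def using label_inj by metis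
  finally show ?case .
next
  case (Suc k)
  have rk: "range (cls k x) = range (cls k x')" using Suc.prems by auto
  then have rv: "range (value_at x k) = range (value_at x' k)" unfolding range_value_at by (simp add: range_name_value_eq_iff)
  have IH: "elem_match k x x' j j' \<longleftrightarrow> value_at x k j = value_at x' k j'" for j j' using Suc by auto
  let ?e = "value_at x (Suc k) i" and ?e' = "value_at x' (Suc k) i'"
  have *: "elem_match (Suc k) x x' i i' \<longleftrightarrow>
     (\<forall>v\<in>range (value_at x k). link k v ?e \<longrightarrow> v \<in> range (value_at x' k) \<and> link k v ?e') \<and>
     (\<forall>v\<in>range (value_at x' k). link k v ?e' \<longrightarrow> v \<in> range (value_at x k) \<and> link k v ?e)"
    unfolding elem_match_Suc generic_bits_Suc IH by (rule range_correspondence)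
  also have "\<dots> \<longleftrightarrow> (\<forall>v\<in>range (name_value k x). link k v ?e = link k v ?e')"
    unfolding rv[symmetric] unfolding range_value_at by blast
  also have "\<dots> \<longleftrightarrow> ?e = ?e'"
    using link_separates[OF rk, of ?e ?e'] by (auto simp: value_at_def)
  finally show ?case .
qed

definition total_match :: "nat \<Rightarrow> 'x \<Rightarrow> 'x \<Rightarrow> bool" where
  "total_match k x x' \<longleftrightarrow> FS_eq_fin (Suc k) (decode_bits (generic_bits x)) (decode_bits (generic_bits x'))"

lemma total_match_H: "total_match k x x' \<longleftrightarrow> (\<forall>i. \<exists>i'. elem_match k x x' i i') \<and> (\<forall>i'. \<exists>i. elem_match k x x' i i')"
  unfolding total_match_def decode_bits_eq_top elem_match_def by simp

text \<open>Every element of sort \<open>k\<close> belongs to some element of sort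
  \<open>k + 1\<close>, and matched sets have matched members.\<close>

lemma total_match_lower:
  assumes "total_match (Suc k) x x'"
  shows "total_match k x x'"
  unfolding total_match_H
proof (intro conjI allI)
  fix j
  obtain i where i: "generic_bits x (Suc k, i, j)" using generic_bits_superset_ex by blast
  obtain i' where "elem_match (Suc k) x x' i i'" using assms unfolding total_match_H by blast
  then show "\<exists>j'. elem_match k x x' j j'" using i unfolding elem_match_Suc by blast
next
  fix j'
  obtain i' where i': "generic_bits x' (Suc k, i', j')" using generic_bits_superset_ex by blast
  obtain i where "elem_match (Suc k) x x' i i'" using assms unfolding total_match_H by blast
  then show "\<exists>j. elem_match k x x' j j'" using i' unfolding elem_match_Suc by blast
qed

lemma total_match_value_at:
  assumes "\<And>j. j < k \<Longrightarrow> range (cls j x) = range (cls j x')"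
  shows "total_match k x x' \<longleftrightarrow> range (cls k x) = range (cls k x')"
proof -
  have elem_match: "elem_match k x x' i i' \<longleftrightarrow> value_at x k i = value_at x' k i'" for i i' using elem_match_iff assms by blast
  have "total_match k x x' \<longleftrightarrow> range (value_at x k) = range (value_at x' k)"
    unfolding total_match_H elem_match using range_correspondence[of "\<lambda>_. True" "value_at x k" "\<lambda>_. True" "value_at x' k"] by auto
  then show ?thesis unfolding range_value_at range_name_value_eq_iff .
qed

text \<open>A match at one sort descends to all lower ones, so the induction has the lower
  equalities at hand before values at sort \<open>k + 1\<close> are compared.\<close>

theorem total_match_iff: "total_match k x x' \<longleftrightarrow> (\<forall>j\<le>k. range (cls j x) = range (cls j x'))"
proof (induction k)
  case 0
  show ?case using total_match_value_at[of 0 x x'] by simp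
next
  case (Suc k)
  show ?case
  proof
    assume t: "total_match (Suc k) x x'"
    then have "\<forall>j\<le>k. range (cls j x) = range (cls j x')" using total_match_lower Suc by blast
    moreover from this have "range (cls (Suc k) x) = range (cls (Suc k) x')"
      using total_match_value_at[of "Suc k" x x'] t by simp
    ultimately show "\<forall>j\<le>Suc k. range (cls j x) = range (cls j x')" by (simp add: le_Suc_eq)
  next
    assume "\<forall>j\<le>Suc k. range (cls j x) = range (cls j x')"
    then show "total_match (Suc k) x x'" using total_match_value_at[of "Suc k" x x'] by simp
  qed
qed

end

section \<open>Borel dependence of the construction on the point\<close>

lemma pred_map_eq:
  assumes "\<And>a k. Measurable.pred M (\<lambda>x. f a x = k)"
  shows "Measurable.pred M (\<lambda>x. map (\<lambda>a. f a x) os = K)"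
proof (induction os arbitrary: K)
  case Nil then show ?case by simp
next
  case (Cons a os)
  note [measurable] = Cons assms
  show ?case by (cases K) simp_all
qed

locale measurable_generic_tower = generic_tower cls mem rho U \<psi> p
  for cls :: "nat \<Rightarrow> 'x \<Rightarrow> 'o::countable \<Rightarrow> 'c"
    and mem :: "nat \<Rightarrow> 'c \<Rightarrow> 'c \<Rightarrow> bool"
    and rho :: "'c \<Rightarrow> nat \<Rightarrow> bool"
    and U :: "nat \<Rightarrow> cond \<Rightarrow> bool" and \<psi> :: "nat \<Rightarrow> (nat \<Rightarrow> bool) \<Rightarrow> nat \<Rightarrow> bool" and p :: cond +
  fixes M :: "'x measure"
  assumes cls_measurable [measurable]: "\<And>k a a'. Measurable.pred M (\<lambda>x. cls k x a = cls k x a')"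
    and mem_measurable [measurable]: "\<And>k a b. Measurable.pred M (\<lambda>x. mem k (cls k x a) (cls (Suc k) x b))"
    and rho_measurable [measurable]: "\<And>a m. Measurable.pred M (\<lambda>x. rho (cls 0 x a) m)"
begin

lemma name_value_eq_measurable [measurable]: "Measurable.pred M (\<lambda>x. name_value k x \<nu> = name_value k x \<nu>')"
proof -
  obtain os t os' t' where \<nu>: "\<nu> = (os, t)" "\<nu>' = (os', t')" by (cases \<nu>, cases \<nu>') auto
  have "Measurable.pred M (\<lambda>x. map (cls k x) os = map (cls k x) os')"
  proof (induction os arbitrary: os')
    case Nil then show ?case by simp
  next
    case (Cons a os)
    note [measurable] = Cons
    show ?case by (cases os') simp_all
  qed
  then show ?thesis unfolding \<nu> name_value_def by simp
qed

lemma matrix_measurable: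
  assumes [measurable]: "\<And>a b. Measurable.pred M (\<lambda>x. r a b x)"
  shows "Measurable.pred M (\<lambda>x. map (\<lambda>b. map (\<lambda>a. r a b x) os) os' = K)"
  by (intro pred_map_eq) measurable

lemma link_measurable [measurable]: "Measurable.pred M (\<lambda>x. link k (name_value k x \<nu>) (name_value (Suc k) x \<nu>'))"
proof -
  obtain os t os' t' where \<nu>: "\<nu> = (os, t)" "\<nu>' = (os', t')" by (cases \<nu>, cases \<nu>') auto
  have [measurable]:
    "\<And>K. Measurable.pred M (\<lambda>x. map (\<lambda>b. map (\<lambda>a. mem k (cls k x a) (cls (Suc k) x b)) os) os' = K)"
    "\<And>K. Measurable.pred M (\<lambda>x. map (\<lambda>a. map (\<lambda>b. mem k (cls k x a) (cls (Suc k) x b)) os') os = K)"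
    by (intro matrix_measurable mem_measurable)+
  \<comment> \<open>There are countably many Boolean matrices \<open>K\<close>, so quantifying over
    them is harmless.\<close>
  have "link k (name_value k x \<nu>) (name_value (Suc k) x \<nu>') \<longleftrightarrow>
    (if t > t' then \<exists>K. map (\<lambda>b. map (\<lambda>a. mem k (cls k x a) (cls (Suc k) x b)) os) os' = K \<and> (t', K) \<in> tag_up t
     else \<exists>K. map (\<lambda>a. map (\<lambda>b. mem k (cls k x a) (cls (Suc k) x b)) os') os = K \<and> (t, K) \<in> tag_down t')" for x
    unfolding \<nu> link_def name_value_def by (simp add: comp_def)
  then show ?thesis by simp
qed

lemma label_measurable [measurable]: "Measurable.pred M (\<lambda>x. label (name_value 0 x \<nu>) b)"
proof -
  obtain os t where \<nu>: "\<nu> = (os, t)" by (cases \<nu>) auto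
  obtain l where l: "\<And>w w'. (\<forall>m<l. w m = w' m) \<Longrightarrow> \<psi> t w b = \<psi> t w' b" using psi_local[of t b] by blast
  have [measurable]: "Measurable.pred M (\<lambda>x. list_code (map (cls 0 x) os) m)" for m
  proof (cases "fst (prod_decode m) < length os")
    case True
    then have "list_code (map (cls 0 x) os) m \<longleftrightarrow> snd (prod_decode m) = 0 \<or>
        rho (cls 0 x (os ! fst (prod_decode m))) (snd (prod_decode m) - 1)" for x
      by (simp add: list_code_def Let_def)
    then show ?thesis by simp
  qed (simp add: list_code_def Let_def)
  have [measurable]: "Measurable.pred M (\<lambda>x. map (\<lambda>m. list_code (map (cls 0 x) os) m) [0..<l] = K)" for K
    by (intro pred_map_eq) measurable
  \<comment> \<open>Only the first \<open>l\<close> bits of the branch matter, so the label bit is a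
    function of one of countably many words \<open>K\<close>.\<close>
  have eq: "label (name_value 0 x \<nu>) b \<longleftrightarrow> (\<exists>K. map (\<lambda>m. list_code (map (cls 0 x) os) m) [0..<l] = K \<and> \<psi> t (\<lambda>m. K ! m) b)" for x
  proof -
    have "\<psi> t (list_code (map (cls 0 x) os)) b = \<psi> t (\<lambda>m. map (\<lambda>m. list_code (map (cls 0 x) os) m) [0..<l] ! m) b"
      by (rule l) simp
    then show ?thesis by (simp add: \<nu> name_value_def label_def)
  qed
  show ?thesis unfolding eq by measurable
qed

lemma state_bits_measurable [measurable]: "Measurable.pred M (\<lambda>x. state_bits x \<sigma> c = Some b)"
proof -
  obtain k i j where c: "c = (k, i, j)" by (cases c) auto
  show ?thesis unfolding c by (cases k) (simp_all add: state_bits_0 state_bits_Suc)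
qed

lemma map_le_state_bits_measurable [measurable]: "Measurable.pred M (\<lambda>x. q \<subseteq>\<^sub>m state_bits x \<sigma>)"
proof -
  have "q \<subseteq>\<^sub>m state_bits x \<sigma> \<longleftrightarrow> (\<forall>c. \<forall>b. q c = Some b \<longrightarrow> state_bits x \<sigma> c = Some b)" for x
    unfolding map_le_def by (metis domI domIff not_None_eq)
  then show ?thesis by simp
qed

lemma good_measurable [measurable]: "Measurable.pred M (\<lambda>x. good x \<sigma>)"
proof -
  have "Measurable.pred M (\<lambda>x. distinct (map (name_value k x) xs))" for k xs
  proof (induction xs)
    case Nil then show ?case by simp
  next
    case (Cons \<nu> xs)
    note [measurable] = Cons
    have "name_value k x \<nu> \<in> name_value k x ` set xs \<longleftrightarrow> (\<exists>\<nu>'. \<nu>' \<in> set xs \<and> name_value k x \<nu> = name_value k x \<nu>')" for x by auto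
    then show ?case by simp
  qed
  note [measurable] = this
  show ?thesis unfolding good_def by simp
qed

lemma meets_measurable [measurable]: "Measurable.pred M (\<lambda>x. meets x r \<sigma>)"
proof -
  obtain k :: nat and \<nu> :: "'o list \<times> nat" where r: "from_nat r = (k, \<nu>)"
    by (cases "from_nat r :: nat \<times> 'o list \<times> nat") auto
  have "name_value k x \<nu> \<in> name_value k x ` set xs \<longleftrightarrow> (\<exists>\<nu>'. \<nu>' \<in> set xs \<and> name_value k x \<nu> = name_value k x \<nu>')" for x xs by auto
  then show ?thesis unfolding meets_def r by simp
qed

lemma state_measurable [measurable]: "(\<lambda>x. state x r) \<in> M \<rightarrow>\<^sub>M count_space UNIV"
proof (induction r)
  case 0
  have "(\<lambda>x. LEAST m. good x (from_nat m) \<and> p \<subseteq>\<^sub>m state_bits x (from_nat m)) \<in> M \<rightarrow>\<^sub>M count_space UNIV"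
    by measurable
  then show ?case unfolding state.simps by (rule measurable_compose) simp
next
  case (Suc r)
  \<comment> \<open>The previous stage takes countably many values and may be frozen as
    \<open>\<sigma>\<close>.\<close>
  have "(\<lambda>x. (\<lambda>\<sigma> x. \<sigma> @ from_nat (LEAST m. meets x r (\<sigma> @ from_nat m))) (state x r) x) \<in> M \<rightarrow>\<^sub>M count_space UNIV"
  proof (rule measurable_compose_countable[OF _ Suc])
    fix \<sigma> :: "(nat \<times> 'o list \<times> nat) list"
    have "(\<lambda>x. LEAST m. meets x r (\<sigma> @ from_nat m)) \<in> M \<rightarrow>\<^sub>M count_space UNIV" by measurable
    then show "(\<lambda>x. \<sigma> @ from_nat (LEAST m. meets x r (\<sigma> @ from_nat m))) \<in> M \<rightarrow>\<^sub>M count_space UNIV"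
      by (rule measurable_compose) simp
  qed
  then show ?case by simp
qed

lemma generic_bits_measurable: "Measurable.pred M (\<lambda>x. generic_bits x c)"
proof -
  obtain k i j where c: "c = (k, i, j)" by (cases c) auto
  \<comment> \<open>By stage \<open>R\<close> all names that the coordinate \<open>c\<close> refers
    to are listed.\<close>
  define R where "R = Suc (k + i + j)"
  have "generic_bits x c \<longleftrightarrow> state_bits x (state x R) c = Some True" for x
  proof -
    have "i < length (sort_part k (state x R))" "j < length (sort_part (k - 1) (state x R))"
      unfolding R_def by (rule length_sort_part_st; simp)+
    then have "state_bits x (state x R) c \<noteq> None" unfolding c by (cases k) (simp_all add: state_bits_0 state_bits_Suc)
    then show ?thesis using state_bits_generic_bits[of x R c] by auto
  qed
  moreover have "Measurable.pred M (\<lambda>x. (\<lambda>\<sigma> x. state_bits x \<sigma> c = Some True) (state x R) x)"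
    by (rule measurable_compose_countable[OF _ state_measurable]) measurable
  ultimately show ?thesis by simp
qed

end

section \<open>The tower of hereditary elements of a point\<close>

text \<open>Entries at depth \<open>l\<close> are squeezed into the interval from \<open>l\<close>
  to \<open>l + 1\<close>, so equality of entries reveals the depth. Otherwise elements at positions
  of different depth could be confused when classes are compared.\<close>

definition levelled :: "(nat list \<Rightarrow> real) \<Rightarrow> nat list \<Rightarrow> real" where
  "levelled x s = real (length s) + (arctan (x s) / pi + 1 / 2)"

lemma levelled_bounds: "real (length s) < levelled x s" "levelled x s < real (length s) + 1"
  using arctan_bounded[of "x s"] pi_gt_zero by (auto simp: levelled_def field_simps)

lemma levelled_eq_length:
  assumes "levelled x s = levelled x' s'"
  shows "length s = length s'"
  using levelled_bounds[where x = x and s = s] levelled_bounds[where x = x' and s = s'] assms by linarith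

definition subtree :: "(nat list \<Rightarrow> real) \<Rightarrow> nat list \<Rightarrow> nat list \<Rightarrow> real" where
  "subtree x s = (\<lambda>u. levelled x (s @ u))"

lemma FS_component_sub: "FS_component (subtree x s) i = subtree x (s @ [i])"
  by (simp add: FS_component_def subtree_def)

text \<open>Classes are formed in the whole function space, which allows classes arising from
  different points to coincide.\<close>

definition eq_class :: "nat \<Rightarrow> (nat list \<Rightarrow> real) \<Rightarrow> (nat list \<Rightarrow> real) set" where
  "eq_class m u = {y. FS_eq_fin m u y}"

lemma eq_class_eq_iff: "eq_class m u = eq_class m v \<longleftrightarrow> FS_eq_fin m u v"
proof
  assume "eq_class m u = eq_class m v"
  moreover have "v \<in> eq_class m v" by (simp add: eq_class_def FS_eq_fin_refl)
  ultimately show "FS_eq_fin m u v" by (simp add: eq_class_def set_eq_iff)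
next
  assume "FS_eq_fin m u v"
  then show "eq_class m u = eq_class m v"
    unfolding eq_class_def using FS_eq_fin_sym FS_eq_fin_trans by blast
qed

text \<open>An object \<open>Some (j, s)\<close> stands for the \<open>j\<close>-fold singleton of the hereditary element at position
  \<open>s\<close>. The object \<open>None\<close> is a point that is its own only element and that is put into every
  hereditary element, but not into the singletons.\<close>

definition hcls :: "nat \<Rightarrow> (nat list \<Rightarrow> real) \<Rightarrow> (nat \<times> nat list) option \<Rightarrow> (nat \<times> (nat list \<Rightarrow> real) set) option" where
  "hcls k x a = (case a of None \<Rightarrow> None
     | Some (j, s) \<Rightarrow> if j \<le> k then Some (j, eq_class (k - j) (subtree x s)) else None)"

definition hmem :: "nat \<Rightarrow> (nat \<times> (nat list \<Rightarrow> real) set) option \<Rightarrow> (nat \<times> (nat list \<Rightarrow> real) set) option \<Rightarrow> bool" where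
  "hmem k c d = (case d of None \<Rightarrow> c = None
     | Some (j, S) \<Rightarrow> (case j of
         0 \<Rightarrow> c = None \<or> (\<exists>T. c = Some (0, T) \<and> (\<exists>y\<in>S. \<exists>i. FS_component y i \<in> T))
       | Suc j' \<Rightarrow> c = Some (j', S)))"

text \<open>Bit 0 tells a real from \<open>None\<close>; the remaining bits are the cut of the real
  in an enumeration of the rationals.\<close>

definition hrho :: "(nat \<times> (nat list \<Rightarrow> real) set) option \<Rightarrow> nat \<Rightarrow> bool" where
  "hrho c m = (case c of None \<Rightarrow> False
     | Some (j, S) \<Rightarrow> m = 0 \<or> (\<exists>y\<in>S. of_rat (from_nat (m - 1)) < y []))"

lemma hmem_simps:
  "hmem k c None \<longleftrightarrow> c = None"
  "hmem k c (Some (Suc j, S)) \<longleftrightarrow> c = Some (j, S)"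
  "hmem k None (Some (0, S))"
  "hmem k (Some (Suc j, T)) (Some (0, S)) \<longleftrightarrow> False"
  by (auto simp: hmem_def)

lemma hmem_hereditary:
  "hmem k (Some (0, eq_class k v)) (Some (0, eq_class (Suc k) (subtree x s))) \<longleftrightarrow> (\<exists>i. FS_eq_fin k v (subtree x (s @ [i])))"
proof
  assume "hmem k (Some (0, eq_class k v)) (Some (0, eq_class (Suc k) (subtree x s)))"
  then obtain y i where y: "FS_eq_fin (Suc k) (subtree x s) y" "FS_eq_fin k v (FS_component y i)"
    by (auto simp: hmem_def eq_class_def)
  from y(1) obtain i' where "FS_eq_fin k (subtree x (s @ [i'])) (FS_component y i)"
    by (auto simp: FS_component_sub)
  then show "\<exists>i. FS_eq_fin k v (subtree x (s @ [i]))" using y(2) FS_eq_fin_sym FS_eq_fin_trans by blast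
next
  assume "\<exists>i. FS_eq_fin k v (subtree x (s @ [i]))"
  then obtain i where "FS_component (subtree x s) i \<in> eq_class k v" by (auto simp: eq_class_def FS_component_sub)
  moreover have "subtree x s \<in> eq_class (Suc k) (subtree x s)" unfolding eq_class_def using FS_eq_fin_refl by blast
  ultimately show "hmem k (Some (0, eq_class k v)) (Some (0, eq_class (Suc k) (subtree x s)))" by (auto simp: hmem_def)
qed

lemma hcls_None: "hcls k x None = None"
  by (simp add: hcls_def)

lemma hcls_Some: "j \<le> k \<Longrightarrow> hcls k x (Some (j, s)) = Some (j, eq_class (k - j) (subtree x s))"
  by (simp add: hcls_def)

lemma hcls_cases:
  obtains "hcls k x a = None" | j s where "a = Some (j, s)" "j \<le> k" "hcls k x a = Some (j, eq_class (k - j) (subtree x s))"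
proof (cases a)
  case None
  then show ?thesis using that(1) by (simp add: hcls_def)
next
  case (Some js)
  obtain j s where js: "js = (j, s)" by fastforce
  show ?thesis using that Some js by (cases "j \<le> k") (auto simp: hcls_def)
qed

text \<open>At least one of the two elements is not \<open>None\<close>, and its singleton contains
  that element only.\<close>

lemma hcls_sep:
  assumes "hcls k x a \<noteq> hcls k x a'"
  shows "\<exists>b. hmem k (hcls k x a) (hcls (Suc k) x b) \<noteq> hmem k (hcls k x a') (hcls (Suc k) x b)"
proof -
  have *: "hmem k c (hcls (Suc k) x (Some (Suc j, s))) \<longleftrightarrow> c = hcls k x (Some (j, s))" if "j \<le> k" for c j s
    using that by (simp add: hcls_Some hmem_simps)
  show ?thesis
  proof (cases rule: hcls_cases[of k x a])
    case (2 j s)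
    then show ?thesis using *[of j] assms by (intro exI[of _ "Some (Suc j, s)"]) auto
  next
    case 1
    show ?thesis
    proof (cases rule: hcls_cases[of k x a'])
      case (2 j s)
      then show ?thesis using *[of j] assms by (intro exI[of _ "Some (Suc j, s)"]) auto
    qed (use 1 assms in auto)
  qed
qed

lemma hcls_Suc_cases:
  obtains "hcls (Suc k) x b = None"
  | s where "hcls (Suc k) x b = Some (0, eq_class (Suc k) (subtree x s))"
  | j s where "j \<le> k" "hcls (Suc k) x b = Some (Suc j, eq_class (k - j) (subtree x s))"
proof (cases rule: hcls_cases[of "Suc k" x b])
  case (2 j s)
  then show ?thesis using that by (cases j) auto
qed (use that in auto)

text \<open>\<open>None\<close> tells hereditary elements from singletons: without it, a hereditary
  set with only one class of members would have the same members as a singleton. Hereditary sets are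
  nonempty, so they also differ from \<open>None\<close>. Two of them are separated by a component
  of one that is missing in the other.\<close>

lemma hcls_ext_aux:
  assumes rg: "range (hcls k x) = range (hcls k x')"
    and ne: "hcls (Suc k) x b \<noteq> hcls (Suc k) x' b'"
  shows "\<exists>c\<in>range (hcls k x). hmem k c (hcls (Suc k) x b) \<noteq> hmem k c (hcls (Suc k) x' b')"
proof -
  have N: "None \<in> range (hcls k x)" using hcls_None rangeI by metis
  have R: "Some (j, eq_class (k - j) (subtree x s)) \<in> range (hcls k x)" if "j \<le> k" for j s
    using hcls_Some[OF that] rangeI by metis
  have R': "Some (j, eq_class (k - j) (subtree x' s)) \<in> range (hcls k x)" if "j \<le> k" for j s
    unfolding rg using hcls_Some[OF that] rangeI by metis
  have R0: "Some (0, eq_class k (subtree x s)) \<in> range (hcls k x)" "Some (0, eq_class k (subtree x' s)) \<in> range (hcls k x)" for s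
    using R[of 0 s] R'[of 0 s] by auto
  have self: "hmem k (Some (0, eq_class k (subtree y (s @ [i])))) (Some (0, eq_class (Suc k) (subtree y s)))" for y s i
    unfolding hmem_hereditary using FS_eq_fin_refl by blast
  show ?thesis
  proof (cases rule: hcls_Suc_cases[of k x b])
    case b: 1
    show ?thesis
    proof (cases rule: hcls_Suc_cases[of k x' b'])
      case 1 then show ?thesis using b ne by simp
    next
      case (2 s)
      show ?thesis unfolding b 2
        by (rule bexI[OF _ R0(2)[of "s @ [0]"]]) (use self[of x' s 0] in \<open>simp add: hmem_simps\<close>)
    next
      case (3 j s)
      show ?thesis unfolding b 3 by (rule bexI[OF _ N]) (simp add: hmem_simps)
    qed
  next
    case b: (2 t)
    show ?thesis
    proof (cases rule: hcls_Suc_cases[of k x' b'])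
      case 1
      show ?thesis unfolding b 1
        by (rule bexI[OF _ R0(1)[of "t @ [0]"]]) (use self[of x t 0] in \<open>simp add: hmem_simps\<close>)
    next
      case (2 s)
      have "\<not> FS_eq_fin (Suc k) (subtree x t) (subtree x' s)" using ne unfolding b 2 by (simp add: eq_class_eq_iff del: FS_eq_fin.simps)
      then consider i where "\<not> (\<exists>j. FS_eq_fin k (subtree x (t @ [i])) (subtree x' (s @ [j])))"
        | j where "\<not> (\<exists>i. FS_eq_fin k (subtree x (t @ [i])) (subtree x' (s @ [j])))"
        by (auto simp: FS_component_sub)
      then show ?thesis
      proof cases
        case (1 i)
        show ?thesis unfolding b 2
          by (rule bexI[OF _ R0(1)[of "t @ [i]"]]) (use self[of x t i] 1 in \<open>simp add: hmem_hereditary\<close>)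
      next
        case (2 j)
        then have "\<not> (\<exists>i. FS_eq_fin k (subtree x' (s @ [j])) (subtree x (t @ [i])))" using FS_eq_fin_sym by blast
        then show ?thesis unfolding b \<open>hcls (Suc k) x' b' = _\<close>
          by (intro bexI[OF _ R0(2)[of "s @ [j]"]]) (use self[of x' s j] in \<open>simp add: hmem_hereditary\<close>)
      qed
    next
      case (3 j s)
      show ?thesis unfolding b 3 by (rule bexI[OF _ N]) (simp add: hmem_simps)
    qed
  next
    case b: (3 j t)
    show ?thesis
    proof (cases rule: hcls_Suc_cases[of k x' b'])
      case 1
      show ?thesis unfolding b 1 by (rule bexI[OF _ N]) (simp add: hmem_simps)
    next
      case (2 s)
      show ?thesis unfolding b 2 by (rule bexI[OF _ N]) (simp add: hmem_simps)
    next
      case (3 j' s)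
      show ?thesis unfolding b 3
        by (rule bexI[OF _ R[of j t]]) (use b 3 ne in \<open>auto simp: hmem_simps\<close>)
    qed
  qed
qed

lemma hcls_ext:
  assumes "range (hcls k x) = range (hcls k x')" "hcls (Suc k) x b \<noteq> hcls (Suc k) x' b'"
  shows "\<exists>a. hmem k (hcls k x a) (hcls (Suc k) x b) \<noteq> hmem k (hcls k x a) (hcls (Suc k) x' b')"
  using hcls_ext_aux[OF assms] by auto

lemma hrho_0: "hrho (Some (0, eq_class 0 (subtree x s))) m \<longleftrightarrow> m = 0 \<or> of_rat (from_nat (m - 1)) < levelled x s"
  by (auto simp: hrho_def eq_class_def subtree_def intro: exI[of _ "\<lambda>_. levelled x s"])

lemma hcls_0_cases:
  obtains "hcls 0 x a = None" | s where "hcls 0 x a = Some (0, eq_class 0 (subtree x s))"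
  by (cases rule: hcls_cases[of 0 x a]) auto

lemma real_eq_if_rat_cuts:
  assumes "\<And>m :: nat. of_rat (from_nat m) < (u :: real) \<longleftrightarrow> of_rat (from_nat m) < v"
  shows "u = v"
proof (rule ccontr)
  have *: "of_rat r < u \<longleftrightarrow> of_rat r < v" for r using assms[of "to_nat r"] by simp
  assume "u \<noteq> v"
  then consider "u < v" | "v < u" by linarith
  then show False
    by cases (use of_rat_dense * in \<open>metis less_asym\<close>)+
qed

lemma hrho_inj:
  assumes "hrho (hcls 0 x a) = hrho (hcls 0 x' a')"
  shows "hcls 0 x a = hcls 0 x' a'"
proof (cases rule: hcls_0_cases[of x a])
  case 1
  then have "\<not> hrho (hcls 0 x' a') 0" using fun_cong[OF assms, of 0] by (simp add: hrho_def)
  then show ?thesis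
    by (cases rule: hcls_0_cases[of x' a']) (use 1 in \<open>auto simp: hrho_0\<close>)
next
  case (2 s)
  then have "hrho (hcls 0 x' a') 0" using fun_cong[OF assms, of 0] by (simp add: hrho_0)
  then obtain s' where s': "hcls 0 x' a' = Some (0, eq_class 0 (subtree x' s'))"
    by (cases rule: hcls_0_cases[of x' a']) (auto simp: hrho_def)
  have "levelled x s = levelled x' s'"
  proof (rule real_eq_if_rat_cuts)
    fix m :: nat
    show "of_rat (from_nat m) < levelled x s \<longleftrightarrow> of_rat (from_nat m) < levelled x' s'"
      using fun_cong[OF assms, of "Suc m"] unfolding 2 s' hrho_0 by simp
  qed
  then show ?thesis unfolding 2 s' by (simp add: eq_class_eq_iff subtree_def)
qed

section \<open>Borel measurability of the tower\<close>

lemma FS_eq_fin_measurable: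
  assumes "\<And>u. (\<lambda>x. f x u) \<in> borel_measurable M" "\<And>u. (\<lambda>x. g x u) \<in> borel_measurable M"
  shows "Measurable.pred M (\<lambda>x. FS_eq_fin k (f x) (g x))"
  using assms
proof (induction k arbitrary: f g)
  case 0
  note [measurable] = 0
  show ?case unfolding FS_eq_fin.simps by measurable
next
  case (Suc k)
  have [measurable]: "Measurable.pred M (\<lambda>x. FS_eq_fin k (FS_component (f x) i) (FS_component (g x) j))" for i j
    by (rule Suc.IH) (auto simp: FS_component_def Suc.prems)
  show ?case unfolding FS_eq_fin.simps by measurable
qed

lemma levelled_measurable [measurable]: "(\<lambda>x. levelled x s) \<in> borel_measurable borel"
proof -
  have [measurable]: "(\<lambda>x :: nat list \<Rightarrow> real. x s) \<in> borel_measurable borel"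
    by (intro borel_measurable_continuous_onI continuous_on_product_coordinates)
  show ?thesis unfolding levelled_def by measurable
qed

lemma subtree_eq_measurable [measurable]: "Measurable.pred borel (\<lambda>x. FS_eq_fin k (subtree x s) (subtree x s'))"
  by (rule FS_eq_fin_measurable) (auto simp: subtree_def)

lemma hcls_eq_measurable: "Measurable.pred borel (\<lambda>x. hcls k x a = hcls k x a')"
proof -
  have None: "Measurable.pred borel (\<lambda>x. hcls k x b = None)" for b
    by (simp add: hcls_def split: option.split)
  show ?thesis
  proof (cases "a = None \<or> a' = None")
    case True
    then show ?thesis using None[of a] None[of a'] by (auto simp: hcls_None eq_commute[of None])
  next
    case False
    then obtain j s j' s' where a: "a = Some (j, s)" "a' = Some (j', s')" by auto
    have eq: "hcls k x a = hcls k x a' \<longleftrightarrow>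
        (if j \<le> k then j' = j \<and> FS_eq_fin (k - j) (subtree x s) (subtree x s') else \<not> j' \<le> k)" for x
      using eq_class_eq_iff[of "k - j" "subtree x s" "subtree x s'"] unfolding a hcls_def by auto
    show ?thesis unfolding eq by measurable
  qed
qed

lemma hmem_measurable: "Measurable.pred borel (\<lambda>x. hmem k (hcls k x a) (hcls (Suc k) x b))"
proof (cases b)
  case None
  then have eq: "hmem k (hcls k x a) (hcls (Suc k) x b) \<longleftrightarrow> hcls k x a = hcls k x None" for x
    by (simp add: hcls_None hmem_simps)
  show ?thesis unfolding eq by (rule hcls_eq_measurable)
next
  case (Some js)
  obtain j s where js: "js = (j, s)" by fastforce
  show ?thesis
  proof (cases j)
    case 0
    show ?thesis
    proof (cases a)
      case None
      then show ?thesis using Some js 0 by (simp add: hcls_def hmem_simps)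
    next
      case a: (Some kt)
      obtain i t where kt: "kt = (i, t)" by fastforce
      have "hmem k (hcls k x a) (hcls (Suc k) x b) \<longleftrightarrow>
         (if i \<le> k then i = 0 \<and> (\<exists>l. FS_eq_fin k (subtree x t) (subtree x (s @ [l]))) else True)" for x
        using Some js 0 a kt by (cases i) (auto simp: hcls_def hmem_simps hmem_hereditary)
      then show ?thesis by simp
    qed
  next
    case (Suc j')
    have eq: "hmem k (hcls k x a) (hcls (Suc k) x b) \<longleftrightarrow>
        hcls k x a = hcls k x (if j' \<le> k then Some (j', s) else None)" for x
      using Some js Suc by (simp add: hcls_def hmem_simps)
    show ?thesis unfolding eq by (rule hcls_eq_measurable)
  qed
qed

lemma hrho_measurable: "Measurable.pred borel (\<lambda>x. hrho (hcls 0 x a) m)"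
proof (cases a)
  case None
  then show ?thesis by (simp add: hcls_def hrho_def)
next
  case (Some js)
  obtain j s where js: "js = (j, s)" by fastforce
  show ?thesis
  proof (cases j)
    case 0
    then show ?thesis using Some js by (simp add: hcls_def hrho_0)
  next
    case (Suc j')
    then show ?thesis using Some js by (simp add: hcls_def hrho_def)
  qed
qed

section \<open>The tower as an invariant for the iterated jumps\<close>

lemma FS_eq_fin_inj:
  assumes "\<And>a b. h a = h b \<Longrightarrow> a = b"
  shows "FS_eq_fin k (\<lambda>u. h (x u)) (\<lambda>u. h (y u)) \<longleftrightarrow> FS_eq_fin k x y"
proof (induction k arbitrary: x y)
  case 0 then show ?case using assms by auto
next
  case (Suc k)
  have "FS_component (\<lambda>u. h (x u)) i = (\<lambda>u. h (FS_component x i u))" for x i by (simp add: FS_component_def)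
  then show ?case using Suc by simp
qed

lemma FS_eq_fin_levelled: "FS_eq_fin k (levelled x) (levelled y) \<longleftrightarrow> FS_eq_fin k x y"
proof -
  let ?h = "\<lambda>r. real k + (arctan r / pi + 1 / 2)"
  have "FS_eq_fin k (levelled x) (levelled y) \<longleftrightarrow> FS_eq_fin k (\<lambda>u. ?h (x u)) (\<lambda>u. ?h (y u))"
    by (rule FS_eq_fin_cong) (auto simp: levelled_def)
  also have "\<dots> \<longleftrightarrow> FS_eq_fin k x y"
    by (rule FS_eq_fin_inj) (simp add: arctan_eq_iff)
  finally show ?thesis .
qed

lemma FS_eq_fin_descend:
  assumes "FS_eq_fin (length s + m) u v"
  shows "\<exists>s'. length s' = length s \<and> FS_eq_fin m (\<lambda>t. u (s @ t)) (\<lambda>t. v (s' @ t))"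
  using assms
proof (induction s arbitrary: u v)
  case Nil then show ?case by auto
next
  case (Cons i s)
  from Cons.prems have "\<exists>j. FS_eq_fin (length s + m) (FS_component u i) (FS_component v j)" by simp
  then obtain j where "FS_eq_fin (length s + m) (FS_component u i) (FS_component v j)" by blast
  from Cons.IH[OF this] obtain s' where "length s' = length s"
    "FS_eq_fin m (\<lambda>t. u (i # s @ t)) (\<lambda>t. v (j # s' @ t))" by (auto simp: FS_component_def)
  then show ?case by (intro exI[of _ "j # s'"]) auto
qed

lemma FS_eq_fin_common_value:
  "FS_eq_fin k u v \<Longrightarrow> \<exists>t t'. length t = k \<and> length t' = k \<and> u t = v t'"
proof (induction k arbitrary: u v)
  case 0 then show ?case by auto
next
  case (Suc k)
  from Suc.prems have "\<exists>j. FS_eq_fin k (FS_component u 0) (FS_component v j)" by simp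
  then obtain j where "FS_eq_fin k (FS_component u 0) (FS_component v j)" by blast
  from Suc.IH[OF this] obtain t t' where "length t = k" "length t' = k" "u (0 # t) = v (j # t')"
    by (auto simp: FS_component_def)
  then show ?case by (intro exI[of _ "0 # t"] exI[of _ "j # t'"]) auto
qed

text \<open>A hereditary element at position \<open>s\<close> is reached by descending
  \<open>length s\<close> levels, and positions have any length; hence the hypothesis for all
  \<open>m\<close>.\<close>

lemma range_hcls_subset:
  assumes "\<And>m. FS_eq_fin m x x'"
  shows "range (hcls k x) \<subseteq> range (hcls k x')"
proof
  fix c assume "c \<in> range (hcls k x)"
  then obtain a where a: "c = hcls k x a" by blast
  show "c \<in> range (hcls k x')"
  proof (cases rule: hcls_cases[of k x a])
    case 1
    then have "c = hcls k x' None" using a by (simp add: hcls_None)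
    then show ?thesis by blast
  next
    case (2 j s)
    have "FS_eq_fin (length s + (k - j)) (levelled x) (levelled x')" using assms by (simp add: FS_eq_fin_levelled)
    from FS_eq_fin_descend[OF this] obtain s' where "FS_eq_fin (k - j) (subtree x s) (subtree x' s')"
      by (auto simp: subtree_def)
    then have "c = hcls k x' (Some (j, s'))" using a 2 by (simp add: hcls_Some eq_class_eq_iff)
    then show ?thesis by blast
  qed
qed

lemma range_hcls_eq_if_FS_eq_fin:
  assumes "\<And>m. FS_eq_fin m x x'"
  shows "range (hcls k x) = range (hcls k x')"
  using range_hcls_subset[of x x' k] range_hcls_subset[of x' x k] assms FS_eq_fin_sym by blast

text \<open>The matching element might sit at another depth; a common entry of the two equivalent
  subtrees excludes this, as entries carry their depth.\<close>

lemma range_hcls_eqD: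
  assumes "range (hcls k x) = range (hcls k x')"
  shows "\<exists>s'. length s' = length s \<and> FS_eq_fin k (subtree x s) (subtree x' s')"
proof -
  have "hcls k x (Some (0, s)) \<in> range (hcls k x')" using assms by blast
  then obtain a where a: "hcls k x' a = Some (0, eq_class k (subtree x s))" by (auto simp: hcls_Some)
  then obtain s' where "FS_eq_fin k (subtree x s) (subtree x' s')"
    by (cases rule: hcls_cases[of k x' a]) (auto simp: eq_class_eq_iff intro: FS_eq_fin_sym)
  moreover from FS_eq_fin_common_value[OF this] have "length s' = length s"
    by (auto simp: subtree_def dest!: levelled_eq_length)
  ultimately show ?thesis by blast
qed

lemma FS_eq_fin_if_range_hcls_eq:
  assumes "range (hcls k x) = range (hcls k x')"
  shows "FS_eq_fin k x x'"
  using range_hcls_eqD[OF assms, of "[]"] by (simp add: subtree_def FS_eq_fin_levelled)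

lemma FS_eq_fin_Suc_if_range_hcls_eq:
  assumes rg: "range (hcls k x) = range (hcls k x')"
  shows "FS_eq_fin (Suc k) x x'"
proof -
  have *: "\<exists>j. FS_eq_fin k (subtree x [i]) (subtree x' [j])" if rg: "range (hcls k x) = range (hcls k x')" for x x' i
    using range_hcls_eqD[OF rg, of "[i]"] by (auto simp: length_Suc_conv)
  \<comment> \<open>The components of \<open>x\<close> are its hereditary elements at depth 1, so
    sort \<open>k\<close> alone decides the relation one jump higher.\<close>
  have "FS_eq_fin (Suc k) (subtree x []) (subtree x' [])"
    unfolding FS_eq_fin.simps FS_component_sub append_Nil
    using *[OF rg] *[OF rg[symmetric]] FS_eq_fin_sym by blast
  then have "FS_eq_fin (Suc k) (levelled x) (levelled x')" by (simp add: subtree_def del: FS_eq_fin.simps)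
  then show ?thesis by (simp add: FS_eq_fin_levelled del: FS_eq_fin.simps)
qed

section \<open>The Baire property and the Cantor space of codes\<close>

lemma nowhere_dense_in_meager: "nowhere_dense_in X A \<Longrightarrow> meager_in X A"
  unfolding meager_in_def by (intro conjI exI[of _ "\<lambda>_. A"]) (auto simp: nowhere_dense_in_def)

lemma meager_in_subset: "meager_in X A \<Longrightarrow> B \<subseteq> A \<Longrightarrow> meager_in X B"
  unfolding meager_in_def by blast

lemma meager_in_UN:
  assumes "\<And>i :: nat. meager_in X (A i)"
  shows "meager_in X (\<Union>i. A i)"
proof -
  have "\<forall>i. \<exists>N :: nat \<Rightarrow> 'a set. (\<forall>k. nowhere_dense_in X (N k)) \<and> A i \<subseteq> (\<Union>k. N k)"
    using assms unfolding meager_in_def by blast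
  from choice[OF this] obtain N :: "nat \<Rightarrow> nat \<Rightarrow> 'a set"
    where N: "\<And>i k. nowhere_dense_in X (N i k)" "\<And>i. A i \<subseteq> (\<Union>k. N i k)" by blast
  let ?N = "\<lambda>m. N (fst (prod_decode m)) (snd (prod_decode m))"
  have "A i \<subseteq> (\<Union>m. ?N m)" for i
  proof
    fix a assume "a \<in> A i"
    then obtain k where "a \<in> N i k" using N(2) by blast
    then have "a \<in> ?N (prod_encode (i, k))" by simp
    then show "a \<in> (\<Union>m. ?N m)" by blast
  qed
  moreover have "A i \<subseteq> topspace X" for i using assms unfolding meager_in_def by blast
  ultimately show ?thesis
    unfolding meager_in_def using N(1) by (intro conjI exI[of _ ?N] allI UN_least) auto
qed

lemma meager_in_Un:
  assumes "meager_in X A" "meager_in X B"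
  shows "meager_in X (A \<union> B)"
proof -
  have "meager_in X (\<Union>i :: nat. if i = 0 then A else B)" by (rule meager_in_UN) (use assms in auto)
  then show ?thesis by (rule meager_in_subset) (auto split: if_splits)
qed

lemma nowhere_dense_in_closure_minus_open:
  assumes "openin X V"
  shows "nowhere_dense_in X (X closure_of V - V)"
proof -
  have eq_class: "closedin X (X closure_of V - V)" using assms by (intro closedin_diff) auto
  define I where "I = X interior_of (X closure_of V - V)"
  have I: "I \<subseteq> X closure_of V - V" unfolding I_def by (rule interior_of_subset)
  have "openin X I" by (simp add: I_def)
  from openin_Int_closure_of_eq_empty[OF this, of V] have "I = {}" using I by blast
  then show ?thesis
    unfolding nowhere_dense_in_def closure_of_closedin[OF eq_class] I_def
    using closure_of_subset_topspace[of X V] by blast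
qed

lemma borel_Baire_property:
  assumes "A \<in> sets (borel_of X)"
  shows "\<exists>V N. openin X V \<and> meager_in X N \<and> A - V \<subseteq> N \<and> V - A \<subseteq> N"
proof -
  have "A \<in> sigma_sets (topspace X) {V. openin X V}"
    using assms unfolding borel_of_def by (subst (asm) sets_measure_of) (use openin_subset in auto)
  then show ?thesis
  proof (induction A rule: sigma_sets.induct)
    case (Basic a)
    then show ?case
      by (intro exI[of _ a] exI[of _ "{}"]) (auto intro!: nowhere_dense_in_meager simp: nowhere_dense_in_def)
  next
    case Empty
    show ?case
      by (intro exI[of _ "{}"] exI[of _ "{}"]) (auto intro!: nowhere_dense_in_meager simp: nowhere_dense_in_def)
  next
    case (Compl a)
    then obtain V N where V: "openin X V" "meager_in X N" "a - V \<subseteq> N" "V - a \<subseteq> N" by blast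
    \<comment> \<open>The open set for the complement is the exterior of \<open>V\<close>; the
      boundary left over is nowhere dense.\<close>
    have "V \<subseteq> X closure_of V" using V(1) by (simp add: closure_of_subset openin_subset)
    then show ?case
      using V meager_in_Un[OF V(2) nowhere_dense_in_meager[OF nowhere_dense_in_closure_minus_open[OF V(1)]]]
      by (intro exI[of _ "topspace X - X closure_of V"] exI[of _ "N \<union> (X closure_of V - V)"]) auto
  next
    case (Union a)
    then have "\<forall>i. \<exists>V. \<exists>N. openin X V \<and> meager_in X N \<and> a i - V \<subseteq> N \<and> V - a i \<subseteq> N" by blast
    from choice[OF this] obtain V
      where "\<forall>i. \<exists>N. openin X (V i) \<and> meager_in X N \<and> a i - V i \<subseteq> N \<and> V i - a i \<subseteq> N" by blast
    from choice[OF this] obtain N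
      where VN: "\<forall>i. openin X (V i) \<and> meager_in X (N i) \<and> a i - V i \<subseteq> N i \<and> V i - a i \<subseteq> N i" by blast
    have "openin X (\<Union>i. V i)" using VN by blast
    moreover have "meager_in X (\<Union>i. N i)" using VN meager_in_UN[of X N] by blast
    moreover have "(\<Union>i. a i) - (\<Union>i. V i) \<subseteq> (\<Union>i. N i)" "(\<Union>i. V i) - (\<Union>i. a i) \<subseteq> (\<Union>i. N i)"
      using VN by blast+
    ultimately show ?case by blast
  qed
qed

section \<open>Codes as points of Cantor space\<close>

definition position :: "nat \<times> nat \<times> nat \<Rightarrow> nat list" where
  "position = (\<lambda>(a, b, c). list_decode (prod_encode (a, prod_encode (b, c))))"

definition unposition :: "nat list \<Rightarrow> nat \<times> nat \<times> nat" where
  "unposition s = (fst (prod_decode (list_encode s)), prod_decode (snd (prod_decode (list_encode s))))"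

lemma unposition_position [simp]: "unposition (position c) = c"
  by (cases c) (simp add: position_def unposition_def)

lemma position_unposition [simp]: "position (unposition s) = s"
proof -
  obtain a m where am: "prod_decode (list_encode s) = (a, m)" by fastforce
  obtain b c where bc: "prod_decode m = (b, c)" by fastforce
  have "prod_encode (b, c) = m" using bc by (metis prod_decode_inverse)
  moreover have "prod_encode (a, m) = list_encode s" using am by (metis prod_decode_inverse)
  ultimately show ?thesis by (simp add: position_def unposition_def am bc)
qed

definition cantor :: "(nat list \<Rightarrow> real) set" where
  "cantor = {y. \<forall>s. y s = 0 \<or> y s = 1}"

definition bits :: "(nat list \<Rightarrow> real) \<Rightarrow> nat \<times> nat \<times> nat \<Rightarrow> bool" where
  "bits y c \<longleftrightarrow> y (position c) = 1"

definition emb :: "(nat \<times> nat \<times> nat \<Rightarrow> bool) \<Rightarrow> nat list \<Rightarrow> real" where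
  "emb g s = of_bool (g (unposition s))"

lemma bits_emb [simp]: "bits (emb g) = g"
  by (rule ext) (simp add: bits_def emb_def)

lemma emb_in_cantor [simp]: "emb g \<in> cantor"
  by (simp add: emb_def cantor_def)

definition cyl :: "cond \<Rightarrow> (nat list \<Rightarrow> real) set" where
  "cyl q = {y \<in> cantor. \<forall>c b. q c = Some b \<longrightarrow> bits y c = b}"

lemma cylD: "z \<in> cyl q \<Longrightarrow> q c = Some b \<Longrightarrow> bits z c = b"
  unfolding cyl_def by blast

lemma closed_cantor: "closed cantor"
proof -
  have "closed {y :: nat list \<Rightarrow> real. y s = 0 \<or> y s = 1}" for s
    by (intro closed_Collect_disj closed_Collect_eq continuous_on_product_coordinates continuous_on_const)
  then show ?thesis unfolding cantor_def by (rule closed_Collect_all)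
qed

lemma openin_cyl:
  assumes "finite (dom q)"
  shows "openin (top_of_set cantor) (cyl q)"
proof -
  let ?T = "\<lambda>c. {y :: nat list \<Rightarrow> real. \<bar>y (position c) - of_bool (the (q c))\<bar> < 1 / 2}"
  have "open (\<Inter>c\<in>dom q. ?T c)"
    using assms by (intro open_INT ballI open_Collect_less continuous_intros continuous_on_product_coordinates) auto
  moreover have "cyl q = cantor \<inter> (\<Inter>c\<in>dom q. ?T c)"
  proof (rule set_eqI)
    fix y
    have "(\<forall>c b. q c = Some b \<longrightarrow> bits y c = b) \<longleftrightarrow> (\<forall>c\<in>dom q. y \<in> ?T c)" if y: "y \<in> cantor"
    proof -
      have "bits y c = b \<longleftrightarrow> y \<in> ?T c" if "q c = Some b" for c b
      proof -
        have "y (position c) = 0 \<or> y (position c) = 1" using y by (simp add: cantor_def)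
        then show ?thesis using that by (cases b) (auto simp: bits_def)
      qed
      then have *: "bits y c = b \<longleftrightarrow> y \<in> ?T c" if "q c = Some b" for c b using that by blast
      show ?thesis
      proof
        assume a: "\<forall>c b. q c = Some b \<longrightarrow> bits y c = b"
        show "\<forall>c\<in>dom q. y \<in> ?T c"
        proof
          fix c assume "c \<in> dom q"
          then obtain b where "q c = Some b" by blast
          then show "y \<in> ?T c" using a * by blast
        qed
      next
        assume "\<forall>c\<in>dom q. y \<in> ?T c"
        then show "\<forall>c b. q c = Some b \<longrightarrow> bits y c = b" using * by blast
      qed
    qed
    then show "y \<in> cyl q \<longleftrightarrow> y \<in> cantor \<inter> (\<Inter>c\<in>dom q. ?T c)" unfolding cyl_def by blast
  qed
  ultimately show ?thesis by (auto simp: openin_open)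
qed

lemma cyl_basis:
  assumes "openin (top_of_set cantor) V" "y \<in> V"
  obtains q where "finite (dom q)" "y \<in> cyl q" "cyl q \<subseteq> V"
proof -
  obtain T where T: "open T" "V = cantor \<inter> T" using assms(1) by (auto simp: openin_open)
  have y: "y \<in> cantor" "y \<in> T" using T assms(2) by auto
  have "openin (product_topology (\<lambda>i. euclidean) UNIV) T" using T(1) by (simp add: euclidean_product_topology)
  from product_topology_open_contains_basis[OF this y(2)]
  obtain X where X: "y \<in> (\<Pi>\<^sub>E i\<in>UNIV. X i)" "finite {i. X i \<noteq> UNIV}" "(\<Pi>\<^sub>E i\<in>UNIV. X i) \<subseteq> T"
    by auto
  define q where "q = (\<lambda>c. if X (position c) \<noteq> UNIV then Some (bits y c) else None)"
  have "inj position" by (rule inj_on_inverseI[of _ unposition]) simp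
  then have "finite (position -` {i. X i \<noteq> UNIV})" using X(2) by (rule finite_vimageI[rotated])
  moreover have "dom q = position -` {i. X i \<noteq> UNIV}" by (auto simp: q_def split: if_splits)
  ultimately have "finite (dom q)" by simp
  moreover have "y \<in> cyl q" using y by (auto simp: cyl_def q_def split: if_splits)
  moreover have "cyl q \<subseteq> V"
  proof
    fix z assume z: "z \<in> cyl q"
    then have zc: "z \<in> cantor" by (simp add: cyl_def)
    have "z i \<in> X i" for i
    proof (cases "X i = UNIV")
      case False
      then have "q (unposition i) = Some (bits y (unposition i))" by (simp add: q_def)
      then have "bits z (unposition i) = bits y (unposition i)" by (rule cylD[OF z])
      then have "z i = 1 \<longleftrightarrow> y i = 1" by (simp add: bits_def)
      moreover have "z i = 0 \<or> z i = 1" "y i = 0 \<or> y i = 1" using zc y by (auto simp: cantor_def)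
      ultimately have "z i = y i" by auto
      then show ?thesis using X(1) by auto
    qed simp
    then have "z \<in> T" using X(3) by auto
    then show "z \<in> V" using zc T by auto
  qed
  ultimately show ?thesis using that by blast
qed

lemma emb_in_cyl: "(\<And>c b. q c = Some b \<Longrightarrow> g c = b) \<Longrightarrow> emb g \<in> cyl q"
  by (auto simp: cyl_def)

lemma Polish_cantor: "Polish_space (top_of_set cantor)"
proof -
  have "completely_metrizable_space (top_of_set cantor)"
    by (intro completely_metrizable_space_closedin completely_metrizable_space_euclidean)
      (simp add: closed_cantor)
  moreover have "separable_space (top_of_set cantor)"
  proof -
    define D where "D = range (\<lambda>l. emb (\<lambda>c. map_of l c = Some True))"
    have "countable D" unfolding D_def by simp
    moreover have "D \<subseteq> cantor" unfolding D_def by auto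
    moreover have "D \<inter> V \<noteq> {}" if V: "openin (top_of_set cantor) V" "V \<noteq> {}" for V
    proof -
      obtain y where "y \<in> V" using V by blast
      then obtain q where q: "finite (dom q)" "cyl q \<subseteq> V" using cyl_basis[OF V(1)] by blast
      obtain l where l: "map_of l = q" using finite_map_eq_map_of[OF q(1)] by blast
      have "emb (\<lambda>c. map_of l c = Some True) \<in> cyl q" unfolding l by (rule emb_in_cyl) auto
      then show ?thesis using q(2) unfolding D_def by blast
    qed
    moreover from this have "top_of_set cantor closure_of D = topspace (top_of_set cantor)"
      using dense_intersects_open[of "top_of_set cantor" D] by blast
    ultimately show ?thesis
      unfolding separable_space_def by (intro exI[of _ D] conjI) auto
  qed
  ultimately show ?thesis by (simp add: Polish_space_def)
qed

text \<open>The combinatorial form of being comeager in a cylinder: it gives the construction a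
  countable list of tasks on finite conditions.\<close>

definition forces_into :: "cond \<Rightarrow> (nat \<Rightarrow> cond \<Rightarrow> bool) \<Rightarrow> (nat list \<Rightarrow> real) set \<Rightarrow> bool" where
  "forces_into p U C \<longleftrightarrow> finite (dom p) \<and>
     (\<forall>r q. finite (dom q) \<longrightarrow> (\<exists>q'. finite (dom q') \<and> q \<subseteq>\<^sub>m q' \<and> U r q')) \<and>
     (\<forall>g. (\<forall>c b. p c = Some b \<longrightarrow> g c = b) \<longrightarrow> (\<forall>r. \<exists>q. U r q \<and> (\<forall>c b. q c = Some b \<longrightarrow> g c = b)) \<longrightarrow> emb g \<in> C)"

lemma nowhere_dense_avoid:
  assumes "nowhere_dense_in (top_of_set cantor) W" "finite (dom q)"
  shows "\<exists>q'. finite (dom q') \<and> q \<subseteq>\<^sub>m q' \<and> cyl q' \<inter> W = {}"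
proof -
  let ?Y = "top_of_set cantor"
  have "cyl q \<noteq> {}" using emb_in_cyl[of q "\<lambda>c. q c = Some True"] by auto
  moreover have "?Y interior_of (?Y closure_of W) = {}" using assms(1) by (simp add: nowhere_dense_in_def)
  ultimately have "\<not> cyl q \<subseteq> ?Y closure_of W"
    using interior_of_maximal[OF _ openin_cyl[OF assms(2)]] by blast
  then obtain y where y: "y \<in> cyl q - ?Y closure_of W" by blast
  have "openin ?Y (cyl q - ?Y closure_of W)"
    by (rule openin_diff[OF openin_cyl[OF assms(2)] closedin_closure_of])
  from cyl_basis[OF this y] obtain q1 where q1: "finite (dom q1)" "y \<in> cyl q1" "cyl q1 \<subseteq> cyl q - ?Y closure_of W" by blast
  \<comment> \<open>\<open>q1\<close> need not extend \<open>q\<close> as a map, but both hold at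
    \<open>y\<close>, so they are compatible and \<open>q1 ++ q\<close> extends both.\<close>
  have "cyl (q1 ++ q) \<subseteq> cyl q1"
  proof
    fix z assume z: "z \<in> cyl (q1 ++ q)"
    have "bits z c = b" if c: "q1 c = Some b" for c b
    proof -
      have "(q1 ++ q) c = Some b"
      proof (cases "q c")
        case None then show ?thesis using c by (simp add: map_add_def)
      next
        case (Some b')
        then have "bits y c = b'" using y cylD by blast
        moreover have "bits y c = b" using q1(2) c cylD by blast
        ultimately show ?thesis using Some by (simp add: map_add_def)
      qed
      then show ?thesis by (rule cylD[OF z])
    qed
    then show "z \<in> cyl q1" using z unfolding cyl_def by blast
  qed
  moreover have "W \<subseteq> ?Y closure_of W" using assms(1) by (intro closure_of_subset) (simp add: nowhere_dense_in_def)
  ultimately have "cyl (q1 ++ q) \<inter> W = {}" using q1(3) by blast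
  moreover have "finite (dom (q1 ++ q))" using q1(1) assms(2) by simp
  moreover have "q \<subseteq>\<^sub>m q1 ++ q" by (rule map_le_map_add)
  ultimately show ?thesis by blast
qed

text \<open>By the Baire property \<open>C\<close> agrees with a nonempty open set up to a meager
  set. The cylinder of \<open>p\<close> lies in the open set, and \<open>U r\<close> holds for the
  conditions whose cylinder avoids the \<open>r\<close>-th nowhere dense set covering the meager
  one.\<close>

lemma forces_into_nonmeager:
  assumes "C \<in> sets (borel_of (top_of_set cantor))" "\<not> meager_in (top_of_set cantor) C"
  shows "\<exists>p U. forces_into p U C"
proof -
  let ?Y = "top_of_set cantor"
  obtain V N where V: "openin ?Y V" "meager_in ?Y N" "C - V \<subseteq> N" "V - C \<subseteq> N"
    using borel_Baire_property[OF assms(1)] by blast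
  have "V \<noteq> {}" using V(2,3) meager_in_subset[of ?Y N C] assms(2) by blast
  then obtain y where y: "y \<in> V" by blast
  obtain p where p: "finite (dom p)" "cyl p \<subseteq> V" using cyl_basis[OF V(1) y] by blast
  obtain W where W: "\<And>k :: nat. nowhere_dense_in ?Y (W k)" "N \<subseteq> (\<Union>k. W k)"
    using V(2) unfolding meager_in_def by blast
  define U where "U = (\<lambda>r q. cyl q \<inter> W r = {})"
  have into: "emb g \<in> C" if g: "\<forall>c b. p c = Some b \<longrightarrow> g c = b" "\<forall>r. \<exists>q. U r q \<and> (\<forall>c b. q c = Some b \<longrightarrow> g c = b)" for g
  proof -
    have "emb g \<in> V" using emb_in_cyl[of p g] g(1) p(2) by blast
    moreover have "emb g \<notin> W r" for r using g(2)[rule_format, of r] emb_in_cyl[of _ g] unfolding U_def by blast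
    ultimately show ?thesis using W(2) V(4) by blast
  qed
  have "\<exists>q'. finite (dom q') \<and> q \<subseteq>\<^sub>m q' \<and> U r q'" if "finite (dom q)" for r q
    unfolding U_def by (rule nowhere_dense_avoid[OF W(1) that])
  then have "forces_into p U C"
    unfolding forces_into_def using p(1) into by (intro conjI allI impI)
  then show ?thesis by blast
qed

text \<open>With trivial tasks the same construction serves the whole space.\<close>

lemma forces_into_cantor: "forces_into Map.empty (\<lambda>_ _. True) cantor"
  unfolding forces_into_def by (auto intro: map_le_refl)

lemma sets_borel_of_top_of_set:
  assumes "S \<in> sets borel"
  shows "sets (borel_of (top_of_set S)) = sets (restrict_space borel S)"
proof -
  have "sets (borel_of (top_of_set S)) = sigma_sets S {V. openin (top_of_set S) V}"
    unfolding borel_of_def by (subst sets_measure_of) (use openin_subset in fastforce)+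
  also have "{V. openin (top_of_set S) V} = (\<inter>) S ` {T. open T}" by (auto simp: openin_open)
  also have "sigma_sets S \<dots> = (\<inter>) S ` sigma_sets UNIV {T. open T}"
    using assms by (intro sigma_sets_Int[symmetric]) (auto simp: sets_borel)
  also have "\<dots> = sets (restrict_space borel S)" by (simp add: sets_restrict_space sets_borel)
  finally show ?thesis .
qed

lemma space_borel_of: "space (borel_of X) = topspace X"
  unfolding borel_of_def by (auto simp: space_measure_of_conv)

section \<open>The equivalence relation and the reductions\<close>

definition FS_carrier :: "enat \<Rightarrow> (nat list \<Rightarrow> real) set" where
  "FS_carrier n = (case n of enat k \<Rightarrow> {x. \<forall>s. length s \<noteq> k \<longrightarrow> x s = 0} | \<infinity> \<Rightarrow> UNIV)"

lemma FS_space_eq: "FS_space n = top_of_set (FS_carrier n)"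
  by (cases n) (simp_all add: FS_space_def FS_carrier_def euclidean_product_topology)

lemma closed_FS_carrier: "closed (FS_carrier n)"
proof (cases n)
  case (enat k)
  have "closed {x :: nat list \<Rightarrow> real. length s \<noteq> k \<longrightarrow> x s = 0}" for s
    by (cases "length s = k") (auto intro!: closed_Collect_eq continuous_on_product_coordinates continuous_on_const)
  then show ?thesis unfolding FS_carrier_def enat by (auto intro: closed_Collect_all)
qed (simp add: FS_carrier_def)

lemma FS_eq_fin_FS_proj: "FS_eq_fin k (FS_proj k x) (FS_proj k y) \<longleftrightarrow> FS_eq_fin k x y"
  by (rule FS_eq_fin_cong) (auto simp: FS_proj_def)

lemma FS_eq_enat: "FS_eq (enat k) x y \<longleftrightarrow> FS_eq_fin k x y"
  by (simp add: FS_eq_def)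

lemma FS_eq_infinity: "FS_eq \<infinity> x y \<longleftrightarrow> (\<forall>k. FS_eq_fin k x y)"
  by (simp add: FS_eq_def FS_eq_fin_FS_proj)

lemma equivalence_on_FS_eq: "equivalence_on S (FS_eq n)"
  unfolding equivalence_on_def
  by (cases n) (auto simp: FS_eq_enat FS_eq_infinity FS_eq_fin_refl intro: FS_eq_fin_sym FS_eq_fin_trans)

definition decode :: "enat \<Rightarrow> (nat list \<Rightarrow> real) \<Rightarrow> nat list \<Rightarrow> real" where
  "decode n y = (case n of enat k \<Rightarrow> FS_proj k (decode_bits (bits y)) | \<infinity> \<Rightarrow> decode_bits (bits y))"

text \<open>Being a pullback along \<open>decode\<close>, the relation reduces to the iterated jump
  at once; the work lies in the converse.\<close>

definition jump_pullback :: "enat \<Rightarrow> (nat list \<Rightarrow> real) \<Rightarrow> (nat list \<Rightarrow> real) \<Rightarrow> bool" where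
  "jump_pullback n y y' \<longleftrightarrow> FS_eq n (decode n y) (decode n y')"

lemma decode_in_carrier: "decode n y \<in> FS_carrier n"
  by (cases n) (auto simp: decode_def FS_carrier_def FS_proj_def)

lemma jump_pullback_enat: "jump_pullback (enat k) y y' \<longleftrightarrow> FS_eq_fin k (decode_bits (bits y)) (decode_bits (bits y'))"
  by (simp add: jump_pullback_def decode_def FS_eq_enat FS_eq_fin_FS_proj)

lemma jump_pullback_infinity: "jump_pullback \<infinity> y y' \<longleftrightarrow> (\<forall>k. FS_eq_fin k (decode_bits (bits y)) (decode_bits (bits y')))"
  by (simp add: jump_pullback_def decode_def FS_eq_infinity)

lemma equivalence_on_jump_pullback: "equivalence_on S (jump_pullback n)"
  using equivalence_on_FS_eq[of UNIV n] unfolding equivalence_on_def jump_pullback_def by blast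

lemma bits_measurable [measurable]: "Measurable.pred borel (\<lambda>y. bits y c)"
  unfolding bits_def by measurable

lemma decode_bits_measurable: "(\<lambda>y. decode_bits (bits y) s) \<in> borel_measurable borel"
proof (induction s rule: induct_list012)
  case 1 then show ?case by simp
next
  case (2 i)
  show ?case unfolding decode_bits.simps real_of_bits_def of_bool_def by measurable
next
  case (3 i j s)
  note [measurable] = 3(2)
  show ?case unfolding decode_bits.simps by measurable
qed

lemma decode_measurable: "decode n \<in> borel \<rightarrow>\<^sub>M borel"
proof (rule measurable_coordinatewise_then_product)
  fix s
  show "(\<lambda>y. decode n y s) \<in> borel_measurable borel"
    using decode_bits_measurable[of s] by (cases n; cases "enat (length s) = n") (simp_all add: decode_def FS_proj_def)
qed

lemma sets_borel_of_FS_space: "sets (borel_of (FS_space n)) = sets (restrict_space borel (FS_carrier n))"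
  unfolding FS_space_eq by (intro sets_borel_of_top_of_set borel_closed closed_FS_carrier)

lemma sets_borel_of_cantor: "sets (borel_of (top_of_set cantor)) = sets (restrict_space borel cantor)"
  by (intro sets_borel_of_top_of_set borel_closed closed_cantor)

theorem generic_reduction:
  assumes n: "1 \<le> n" and forces: "forces_into p U C"
  obtains f where "f \<in> borel \<rightarrow>\<^sub>M borel" "\<And>x. f x \<in> C \<inter> cantor"
    "\<And>x x'. x \<in> FS_carrier n \<Longrightarrow> x' \<in> FS_carrier n \<Longrightarrow> FS_eq n x x' \<longleftrightarrow> jump_pullback n (f x) (f x')"
proof -
  note fi = forces[unfolded forces_into_def]
  have p: "finite (dom p)" by (rule conjunct1[OF fi])
  have dense: "\<exists>q'. finite (dom q') \<and> q \<subseteq>\<^sub>m q' \<and> U r q'" if "finite (dom q)" for r q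
    by (rule conjunct1[OF conjunct2[OF fi], rule_format, OF that])
  have into: "emb g \<in> C" if "\<forall>c b. p c = Some b \<longrightarrow> g c = b"
      "\<forall>r. \<exists>q. U r q \<and> (\<forall>c b. q c = Some b \<longrightarrow> g c = b)" for g
    by (rule conjunct2[OF conjunct2[OF fi], THEN spec, THEN mp, THEN mp, OF that])
  obtain \<psi> :: "nat \<Rightarrow> (nat \<Rightarrow> bool) \<Rightarrow> nat \<Rightarrow> bool" where \<psi>:
    "\<And>t w b. b < length (tag_prefix t) \<Longrightarrow> \<psi> t w b = tag_prefix t ! b"
    "\<And>t b. \<exists>l. \<forall>w w'. (\<forall>m<l. w m = w' m) \<longrightarrow> \<psi> t w b = \<psi> t w' b"
    "\<And>t w t' w'. \<psi> t w = \<psi> t' w' \<Longrightarrow> t = t' \<and> w = w'"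
    "\<And>m ns r. finite (dom m) \<Longrightarrow> distinct ns \<Longrightarrow> \<exists>q. finite (dom q) \<and> U r q \<and>
        (\<forall>k i j b b'. q (Suc k, i, j) = Some b \<longrightarrow> m (Suc k, i, j) = Some b' \<longrightarrow> b = b') \<and>
        (\<forall>i<length ns. \<forall>b c. q (0, i, b) = Some c \<longrightarrow> \<psi> (fst (ns ! i)) (snd (ns ! i)) b = c)"
  proof (rule generic_sequences[where U = U and s = tag_prefix])
    fix q :: cond and r assume "finite (dom q)"
    then show "\<exists>q'. finite (dom q') \<and> q \<subseteq>\<^sub>m q' \<and> U r q'" by (rule dense)
  qed (rule that)
  interpret measurable_generic_tower hcls hmem hrho U \<psi> p borel
  proof unfold_locales
    fix m :: cond and ns :: "(nat \<times> (nat \<Rightarrow> bool)) list" and r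
    assume "finite (dom m)" "distinct ns"
    then show "\<exists>q. finite (dom q) \<and> U r q \<and>
        (\<forall>k i j b b'. q (Suc k, i, j) = Some b \<longrightarrow> m (Suc k, i, j) = Some b' \<longrightarrow> b = b') \<and>
        (\<forall>i<length ns. \<forall>b c. q (0, i, b) = Some c \<longrightarrow> \<psi> (fst (ns ! i)) (snd (ns ! i)) b = c)"
      by (rule \<psi>(4))
  qed (erule hcls_sep | erule (1) hcls_ext | erule hrho_inj | erule \<psi>(1) | rule \<psi>(2) | erule \<psi>(3) | rule p |
       rule hcls_eq_measurable | rule hmem_measurable | rule hrho_measurable)+
  define f where "f = (\<lambda>x. emb (generic_bits x))"
  show ?thesis
  proof (rule that[of f])
    show "f \<in> borel \<rightarrow>\<^sub>M borel"
    proof (rule measurable_coordinatewise_then_product)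
      fix s
      note [measurable] = generic_bits_measurable
      show "(\<lambda>x. f x s) \<in> borel_measurable borel"
        unfolding f_def emb_def of_bool_def by measurable
    qed
    show "f x \<in> C \<inter> cantor" for x
      unfolding f_def using into[of "generic_bits x"] generic_bits_p generic_bits_generic[of _ x] by auto
  next
    fix x x' assume x: "x \<in> FS_carrier n" "x' \<in> FS_carrier n"
    \<comment> \<open>Lists of length \<open>k + 1\<close> compare sort \<open>k\<close>, which
      settles all sorts up to \<open>k\<close>.\<close>
    have match: "FS_eq_fin (Suc k) (decode_bits (bits (f x))) (decode_bits (bits (f x'))) \<longleftrightarrow>
        (\<forall>j\<le>k. range (hcls j x) = range (hcls j x'))" for k
      using total_match_iff[of k x x'] unfolding f_def bits_emb total_match_def .
    show "FS_eq n x x' \<longleftrightarrow> jump_pullback n (f x) (f x')"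
    proof (cases n)
      case infinity
      have "(\<forall>k. FS_eq_fin k (decode_bits (bits (f x))) (decode_bits (bits (f x')))) \<longleftrightarrow>
          (\<forall>k. FS_eq_fin (Suc k) (decode_bits (bits (f x))) (decode_bits (bits (f x'))))"
      proof (intro iffI allI)
        fix k assume *: "\<forall>k. FS_eq_fin (Suc k) (decode_bits (bits (f x))) (decode_bits (bits (f x')))"
        show "FS_eq_fin k (decode_bits (bits (f x))) (decode_bits (bits (f x')))"
        \<comment> \<open>At \<open>k = 0\<close> the relation is trivial, since
          \<open>decode_bits\<close> is 0 on the empty list.\<close>
        proof (cases k)
          case (Suc k') then show ?thesis using * by blast
        qed simp
      qed blast
      also have "\<dots> \<longleftrightarrow> (\<forall>j. range (hcls j x) = range (hcls j x'))" unfolding match by blast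
      also have "\<dots> \<longleftrightarrow> (\<forall>k. FS_eq_fin k x x')"
        using FS_eq_fin_if_range_hcls_eq range_hcls_eq_if_FS_eq_fin by blast
      finally show ?thesis unfolding infinity FS_eq_infinity jump_pullback_infinity by blast
    next
      case (enat m)
      \<comment> \<open>Since \<open>n\<close> is at least 1, there is a top sort
        \<open>k = n - 1\<close>.\<close>
      then obtain k where k: "m = Suc k" using n by (cases m) (auto simp: one_enat_def)
      have "FS_eq_fin (Suc k) x x' \<longleftrightarrow> (\<forall>j\<le>k. range (hcls j x) = range (hcls j x'))"
      proof
        assume eq: "FS_eq_fin (Suc k) x x'"
        \<comment> \<open>Both points vanish on lists of length other than \<open>Suc k\<close>, so
          the other relations hold trivially and equivalence at all depths is available.\<close>
        have "FS_eq_fin i x x'" for i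
        proof (cases "i = Suc k")
          case False
          have "FS_eq_fin i x x' \<longleftrightarrow> FS_eq_fin i (\<lambda>_. 0) (\<lambda>_. 0)"
            by (rule FS_eq_fin_cong) (use x False k enat in \<open>auto simp: FS_carrier_def\<close>)
          then show ?thesis by (simp add: FS_eq_fin_refl)
        qed (use eq in simp)
        then show "\<forall>j\<le>k. range (hcls j x) = range (hcls j x')"
          using range_hcls_eq_if_FS_eq_fin by blast
      next
        assume "\<forall>j\<le>k. range (hcls j x) = range (hcls j x')"
        then show "FS_eq_fin (Suc k) x x'" using FS_eq_fin_Suc_if_range_hcls_eq by blast
      qed
      then show ?thesis unfolding enat k FS_eq_enat jump_pullback_enat match .
    qed
  qed
qed

section \<open>Assembling the reductions\<close>

lemma borel_reducible_trans:
  assumes "borel_reducible M E N F" "borel_reducible N F L G"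
  shows "borel_reducible M E L G"
proof -
  obtain f where f: "f \<in> M \<rightarrow>\<^sub>M N" "\<And>x y. x \<in> space M \<Longrightarrow> y \<in> space M \<Longrightarrow> E x y \<longleftrightarrow> F (f x) (f y)"
    using assms(1) unfolding borel_reducible_def by blast
  obtain g where g: "g \<in> N \<rightarrow>\<^sub>M L" "\<And>x y. x \<in> space N \<Longrightarrow> y \<in> space N \<Longrightarrow> F x y \<longleftrightarrow> G (g x) (g y)"
    using assms(2) unfolding borel_reducible_def by blast
  show ?thesis
    unfolding borel_reducible_def
    by (rule bexI[OF _ measurable_compose[OF f(1) g(1)]]) (use f g measurable_space[OF f(1)] in auto)
qed

lemma jump_pullback_reducible:
  "borel_reducible (borel_of (top_of_set cantor)) (jump_pullback n) (borel_of (FS_space n)) (FS_eq n)"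
  unfolding borel_reducible_def
proof (rule bexI)
  show "decode n \<in> borel_of (top_of_set cantor) \<rightarrow>\<^sub>M borel_of (FS_space n)"
    unfolding measurable_cong_sets[OF sets_borel_of_cantor sets_borel_of_FS_space]
    by (intro measurable_restrict_space2 measurable_restrict_space1 decode_measurable)
      (simp add: decode_in_carrier)
qed (simp add: jump_pullback_def)

lemma FS_eq_reducible:
  assumes "1 \<le> n" "forces_into p U C" "C \<subseteq> cantor"
  shows "borel_reducible (borel_of (FS_space n)) (FS_eq n)
           (restrict_space (borel_of (top_of_set cantor)) C) (jump_pullback n)"
proof -
  obtain f where f: "f \<in> borel \<rightarrow>\<^sub>M borel" "\<And>x. f x \<in> C \<inter> cantor"
    "\<And>x x'. x \<in> FS_carrier n \<Longrightarrow> x' \<in> FS_carrier n \<Longrightarrow> FS_eq n x x' \<longleftrightarrow> jump_pullback n (f x) (f x')"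
    using generic_reduction[OF assms(1,2)] by metis
  have "f \<in> restrict_space borel (FS_carrier n) \<rightarrow>\<^sub>M restrict_space borel cantor"
    by (intro measurable_restrict_space2 measurable_restrict_space1 f(1)) (use f(2) in auto)
  then have "f \<in> borel_of (FS_space n) \<rightarrow>\<^sub>M borel_of (top_of_set cantor)"
    unfolding measurable_cong_sets[OF sets_borel_of_FS_space sets_borel_of_cantor] .
  then have "f \<in> borel_of (FS_space n) \<rightarrow>\<^sub>M restrict_space (borel_of (top_of_set cantor)) C"
    by (intro measurable_restrict_space2) (use f(2) in auto)
  then show ?thesis
    unfolding borel_reducible_def
    by (rule bexI[rotated]) (use f(3) in \<open>auto simp: space_borel_of FS_space_eq\<close>)
qed

lemma restrict_space_reducible: "borel_reducible (restrict_space M C) E M E"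
  unfolding borel_reducible_def by (rule bexI[of _ "\<lambda>x. x"]) (auto intro: measurable_restrict_space1)

theorem theorem1p8:
  fixes n :: enat
  assumes "1 \<le> n"
  shows "\<exists>(Y :: (nat list \<Rightarrow> real) topology) (F :: (nat list \<Rightarrow> real) \<Rightarrow> (nat list \<Rightarrow> real) \<Rightarrow> bool).
           Polish_space Y \<and> equivalence_on (topspace Y) F \<and>
           borel_bireducible (borel_of Y) F (borel_of (FS_space n)) (FS_eq n) \<and>
           (\<forall>C \<in> sets (borel_of Y). \<not> meager_in Y C \<longrightarrow>
              borel_bireducible (restrict_space (borel_of Y) C) F (borel_of Y) F)"
proof (intro exI conjI ballI impI)
  let ?Y = "top_of_set cantor" and ?F = "jump_pullback n"
  show "Polish_space ?Y" by (rule Polish_cantor)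
  show "equivalence_on (topspace ?Y) ?F" by (rule equivalence_on_jump_pullback)
  show "borel_bireducible (borel_of ?Y) ?F (borel_of (FS_space n)) (FS_eq n)"
    unfolding borel_bireducible_def
    using jump_pullback_reducible
      borel_reducible_trans[OF FS_eq_reducible[OF assms forces_into_cantor order_refl] restrict_space_reducible]
    by blast
  fix C assume C: "C \<in> sets (borel_of ?Y)" "\<not> meager_in ?Y C"
  have "C \<subseteq> cantor" using sets.sets_into_space[OF C(1)] by (simp add: space_borel_of)
  moreover obtain p U where "forces_into p U C" using forces_into_nonmeager[OF C] by blast
  ultimately have "borel_reducible (borel_of (FS_space n)) (FS_eq n) (restrict_space (borel_of ?Y) C) ?F"
    using FS_eq_reducible[OF assms] by blast
  \<comment> \<open>Decoding followed by the generic coding sends the whole space into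
    \<open>C\<close>.\<close>
  from borel_reducible_trans[OF jump_pullback_reducible this] restrict_space_reducible
  show "borel_bireducible (restrict_space (borel_of ?Y) C) ?F (borel_of ?Y) ?F"
    unfolding borel_bireducible_def by blast
qed

end
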